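(* There is an absolute constant $c>0$ such that for all partial boolean functions $f\colon\{0,1\}^n\to\{0,1,*\}$ and $g\colon\{0,1\}^m\to\{0,1,*\}$, $\mathrm{R}(f\circ g)\ge c\cdot\mathrm{fbs}(f)\cdot\mathrm{R}(g)$.
   Context: $\mathrm{R}(h)$ is the least worst-case number of queries of a randomized decision tree that outputs $h(x)$ with probability $\ge 2/3$ on every input $x$ in the domain of the partial function $h$. The composition $f\circ g\colon(\{0,1\}^m)^n\to\{0,1,*\}$ is $(f\circ g)(x^1,\dots,x^n)=f(g(x^1),\dots,g(x^n))$, defined on inputs where every $g(x^i)\in\{0,1\}$ and $f(g(x^1),\dots,g(x^n))\in\{0,1\}$. Fractional block sensitivity: for $x$ in the domain of $f$ and $B\subseteq[n]$, let $x^B$ be $x$ with the bits in $B$ flipped; $B$ is sensitive on $x$ if $x^B$ is in the domain and $f(x^B)\ne f(x)$. $\mathrm{fbs}(f,x)$ is the optimum of the linear program maximizing $\sum_B w_B$ over nonnegative weights $w_B$ on sensitive blocks $B$ of $x$, subject to $\sum_{B\ni i}w_B\le1$ for all $i\in[n]$; $\mathrm{fbs}(f)=\max_x\mathrm{fbs}(f,x)$. *)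

theory Defs
  imports "HOL-Probability.Probability"
begin

text \<open>
  Bit strings are indexed by an arbitrary finite set \<open>I\<close>, so that \<open>{0,1}^n\<close> is \<open>cube {..<n}\<close>
  and \<open>({0,1}^m)^n\<close> is \<open>cube ({..<n} \<times> {..<m})\<close>.  Strings are extensional
  (\<open>undefined\<close> outside \<open>I\<close>), hence each bit string is represented by exactly one function.
\<close>

definition cube :: "'i set \<Rightarrow> ('i \<Rightarrow> bool) set" where
  "cube I = (I \<rightarrow>\<^sub>E UNIV)"

text \<open>The value \<open>None\<close> plays the role of \<open>*\<close>, so the domain of \<open>h\<close> is \<open>dom h\<close>.\<close>

definition partial_boolfun :: "'i set \<Rightarrow> (('i \<Rightarrow> bool) \<Rightarrow> bool option) \<Rightarrow> bool" where
  "partial_boolfun I h \<longleftrightarrow> dom h \<subseteq> cube I"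

definition row :: "'j set \<Rightarrow> ('i \<times> 'j \<Rightarrow> bool) \<Rightarrow> 'i \<Rightarrow> 'j \<Rightarrow> bool" where
  "row J z i = (\<lambda>j\<in>J. z (i, j))"

definition boolfun_comp ::
  "'i set \<Rightarrow> 'j set \<Rightarrow> (('i \<Rightarrow> bool) \<Rightarrow> bool option) \<Rightarrow> (('j \<Rightarrow> bool) \<Rightarrow> bool option) \<Rightarrow>
    ('i \<times> 'j \<Rightarrow> bool) \<Rightarrow> bool option" where
  "boolfun_comp I J f g z =
    (if z \<in> cube (I \<times> J) \<and> (\<forall>i\<in>I. row J z i \<in> dom g)
     then f (\<lambda>i\<in>I. the (g (row J z i))) else None)"

datatype 'i dtree = Leaf bool | Query 'i "'i dtree" "'i dtree"

primrec dtree_output :: "'i dtree \<Rightarrow> ('i \<Rightarrow> bool) \<Rightarrow> bool" where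
  "dtree_output (Leaf b) x = b"
| "dtree_output (Query i t0 t1) x = (if x i then dtree_output t1 x else dtree_output t0 x)"

primrec dtree_queries :: "'i dtree \<Rightarrow> ('i \<Rightarrow> bool) \<Rightarrow> nat" where
  "dtree_queries (Leaf b) x = 0"
| "dtree_queries (Query i t0 t1) x =
    Suc (if x i then dtree_queries t1 x else dtree_queries t0 x)"

text \<open>
  A randomized decision tree is a probability distribution over deterministic ones.  The worst
  case is taken over all inputs in the cube and all outcomes of the randomness.  Since \<open>set_dtree\<close>
  collects the query labels, the trees only query positions in \<open>I\<close>.
\<close>

definition queries_at_most :: "'i set \<Rightarrow> 'i dtree pmf \<Rightarrow> nat \<Rightarrow> bool" where
  "queries_at_most I D k \<longleftrightarrow>
    (\<forall>t\<in>set_pmf D. set_dtree t \<subseteq> I \<and> (\<forall>x\<in>cube I. dtree_queries t x \<le> k))"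

definition computes :: "'i dtree pmf \<Rightarrow> (('i \<Rightarrow> bool) \<Rightarrow> bool option) \<Rightarrow> bool" where
  "computes D h \<longleftrightarrow>
    (\<forall>x\<in>dom h. measure_pmf.prob D {t. Some (dtree_output t x) = h x} \<ge> 2 / 3)"

definition rand_query :: "'i set \<Rightarrow> (('i \<Rightarrow> bool) \<Rightarrow> bool option) \<Rightarrow> nat" where
  "rand_query I h = (LEAST k. \<exists>D. queries_at_most I D k \<and> computes D h)"

definition flip_block :: "('i \<Rightarrow> bool) \<Rightarrow> 'i set \<Rightarrow> 'i \<Rightarrow> bool" where
  "flip_block x B = (\<lambda>i. if i \<in> B then \<not> x i else x i)"

definition sensitive_blocks ::
  "'i set \<Rightarrow> (('i \<Rightarrow> bool) \<Rightarrow> bool option) \<Rightarrow> ('i \<Rightarrow> bool) \<Rightarrow> 'i set set" where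
  "sensitive_blocks I f x = {B. B \<subseteq> I \<and> flip_block x B \<in> dom f \<and> f (flip_block x B) \<noteq> f x}"

definition feasible_weights ::
  "'i set \<Rightarrow> (('i \<Rightarrow> bool) \<Rightarrow> bool option) \<Rightarrow> ('i \<Rightarrow> bool) \<Rightarrow> ('i set \<Rightarrow> real) set" where
  "feasible_weights I f x =
    {w. (\<forall>B\<in>sensitive_blocks I f x. w B \<ge> 0) \<and>
        (\<forall>i\<in>I. (\<Sum>B | B \<in> sensitive_blocks I f x \<and> i \<in> B. w B) \<le> 1)}"

text \<open>
  For finite \<open>I\<close> and \<open>x \<in> dom f\<close> the supremum is over a nonempty bounded set of reals: \<open>w = 0\<close> is
  feasible, and sensitive blocks are nonempty, so every feasible value is at most \<open>card I\<close>.
\<close>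

definition fbs_at :: "'i set \<Rightarrow> (('i \<Rightarrow> bool) \<Rightarrow> bool option) \<Rightarrow> ('i \<Rightarrow> bool) \<Rightarrow> real" where
  "fbs_at I f x = (SUP w\<in>feasible_weights I f x. \<Sum>B\<in>sensitive_blocks I f x. w B)"

text \<open>For the nowhere defined function the maximum over the empty set is read as 0.\<close>

definition fbs :: "'i set \<Rightarrow> (('i \<Rightarrow> bool) \<Rightarrow> bool option) \<Rightarrow> real" where
  "fbs I f = (if dom f = {} then 0 else Max (fbs_at I f ` dom f))"

end

theory Submission
  imports Defs
begin

text \<open>
  Fix a depth \<open>d\<close> and \<open>\<beta> > 1\<close>. Let a forecast of depth \<open>d\<close> for \<open>g\<close> end in an estimate \<open>r > 0\<close>. If it
  makes \<open>q\<close> queries, it pays \<open>\<beta>^q * r\<close> on a 0-input and \<open>\<beta>^q / r\<close> on a 1-input. If some randomized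
  forecast pays less than 1 in expectation on every input, then running independent copies and
  multiplying the estimates makes the error decay exponentially, at rate \<open>1/\<beta>\<close> per query; with
  \<open>\<beta> = 1 + \<Theta>(1/d)\<close> this gives \<open>R(g) = O(d)\<close>. Otherwise minimax yields distributions \<open>p\<^sub>0\<close>, \<open>p\<^sub>1\<close> on the
  0- and 1-inputs against whose average no forecast pays less than 1.

  Let the potential \<open>V e \<sigma>\<close> be the least payment over the inputs in \<open>\<sigma>\<close> with \<open>e\<close> queries left; it is at
  most the geometric mean of \<open>p\<^sub>0(\<sigma>)\<close> and \<open>p\<^sub>1(\<sigma>)\<close>. Replace the bits of \<open>x\<close>, and of \<open>x\<^sup>B\<close>, by independent rows
  from \<open>p\<^sub>0\<close> and \<open>p\<^sub>1\<close>. At a leaf, the Bhattacharyya affinity of the two distributions is a product over the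
  rows in which the rows in \<open>B\<close> contribute such geometric means, regardless of the bits of \<open>x\<close> on \<open>B\<close>.
  Hence the product of the potentials shows that a tree making at most \<open>d\<close> queries in the rows of \<open>B\<close>
  leaves affinity at least \<open>1 / \<beta>^d\<close>, too much to tell \<open>x\<close> from \<open>x\<^sup>B\<close>. But if \<open>f \<circ> g\<close> has a randomized tree
  of cost \<open>k\<close>, averaging over the fractional packing of blocks gives a tree and a block \<open>B\<close> that it
  distinguishes with only \<open>O(k / fbs)\<close> expected queries in \<open>B\<close> under \<open>x\<close>.
\<close>

subsection \<open>A minimax alternative\<close>

text \<open>Separate \<open>C\<close> from the open negative quadrant by a line. The quadrant is
  unbounded in both directions, so the normal has no negative coordinate; it comes arbitrarily close
  to the origin, so the offset is nonnegative. Scaling the normal to coordinate sum 1 gives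
  \<open>\<alpha>\<close>.\<close>

lemma convex_plane_alternative:
  fixes C :: "(real \<times> real) set"
  assumes "convex C" and "\<not> (\<exists>p q. (p, q) \<in> C \<and> p < 0 \<and> q < 0)"
  obtains \<alpha> where "0 \<le> \<alpha>" "\<alpha> \<le> 1" "\<And>p q. (p, q) \<in> C \<Longrightarrow> 0 \<le> \<alpha> * p + (1 - \<alpha>) * q"
proof (cases "C = {}")
  case True
  with that[of 0] show ?thesis by simp
next
  case False
  let ?N = "{..<0::real} \<times> {..<0::real}"
  have "convex ?N" by (intro convex_Times) auto
  moreover have "?N \<noteq> {}" by (auto intro: exI[of _ "-1"])
  moreover have "?N \<inter> C = {}" using assms(2) by auto
  ultimately obtain a b where "a \<noteq> 0" and lo: "\<forall>z\<in>?N. a \<bullet> z \<le> b" and hi: "\<forall>z\<in>C. b \<le> a \<bullet> z"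
    using separating_hyperplane_sets[of ?N C] assms(1) False by blast
  obtain u v where a: "a = (u, v)" by (cases a)
  have lo': "u * p + v * q \<le> b" if "p < 0" "q < 0" for p q
    using lo that by (auto simp: a)
  have "u \<ge> 0"
  proof (rule ccontr)
    assume "\<not> u \<ge> 0"
    \<comment> \<open>The first coordinate is chosen so that the left side is at least
      \<open>\<bar>b\<bar> + 1\<close>, hence above \<open>b\<close>.\<close>
    then have "u * ((\<bar>b\<bar> + \<bar>v\<bar> + 1) / u) + v * (-1) \<le> b"
      by (intro lo') (auto simp: divide_pos_neg)
    with \<open>\<not> u \<ge> 0\<close> show False by (simp add: abs_if split: if_splits)
  qed
  moreover have "v \<ge> 0"
  proof (rule ccontr)
    assume "\<not> v \<ge> 0"
    then have "u * (-1) + v * ((\<bar>b\<bar> + \<bar>u\<bar> + 1) / v) \<le> b"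
      by (intro lo') (auto simp: divide_pos_neg)
    with \<open>\<not> v \<ge> 0\<close> show False by (simp add: abs_if split: if_splits)
  qed
  moreover have "b \<ge> 0"
  proof (rule ccontr)
    assume "\<not> b \<ge> 0"
    \<comment> \<open>The point \<open>(e, e)\<close> is so close to the origin that its value is at
      least \<open>b / 2\<close>, which exceeds the negative \<open>b\<close>.\<close>
    define e where "e = b / (2 * (\<bar>u\<bar> + \<bar>v\<bar> + 1))"
    have "e < 0" using \<open>\<not> b \<ge> 0\<close> by (auto simp: e_def divide_neg_pos)
    then have "(u + v) * e \<le> b" using lo'[of e e] by (simp add: algebra_simps)
    moreover have "(u + v) * e \<ge> (\<bar>u\<bar> + \<bar>v\<bar> + 1) * e"
      using \<open>e < 0\<close> by (intro mult_right_mono_neg) auto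
    moreover have "(\<bar>u\<bar> + \<bar>v\<bar> + 1) * e = b / 2" by (simp add: e_def field_simps)
    ultimately show False using \<open>\<not> b \<ge> 0\<close> by linarith
  qed
  moreover have "u + v > 0"
    using calculation \<open>a \<noteq> 0\<close> by (auto simp: a prod_eq_iff)
  moreover have "0 \<le> u * p + v * q" if "(p, q) \<in> C" for p q
    using hi that \<open>b \<ge> 0\<close> by (fastforce simp: a)
  moreover have "u / (u + v) * p + (1 - u / (u + v)) * q = (u * p + v * q) / (u + v)" for p q
  proof -
    have "1 - u / (u + v) = v / (u + v)" using \<open>u + v > 0\<close> by (simp add: field_simps)
    then show ?thesis by (simp add: add_divide_distrib)
  qed
  ultimately show ?thesis
    by (intro that[of "u / (u + v)"]) auto
qed

text \<open>Finite minimax by induction on \<open>X\<close>. When \<open>x\<close> is added, no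
  function that is negative at \<open>x\<close> is negative on all of the old \<open>X\<close>, so
  the induction hypothesis supplies weights \<open>a\<close> for these functions. The pairs of value
  at \<open>x\<close> and \<open>a\<close>-average then form a planar convex set that misses the
  open negative quadrant, and the planar case mixes \<open>x\<close> with \<open>a\<close>.\<close>

lemma convex_functions_alternative:
  fixes F :: "('a \<Rightarrow> real) set"
  assumes "finite X" "X \<noteq> {}"
    and "\<And>u v \<alpha>. u \<in> F \<Longrightarrow> v \<in> F \<Longrightarrow> 0 \<le> \<alpha> \<Longrightarrow> \<alpha> \<le> 1 \<Longrightarrow> (\<lambda>x. \<alpha> * u x + (1 - \<alpha>) * v x) \<in> F"
    and "\<not> (\<exists>u\<in>F. \<forall>x\<in>X. u x < 0)"
  shows "\<exists>a. (\<forall>x\<in>X. 0 \<le> a x) \<and> sum a X = 1 \<and> (\<forall>u\<in>F. 0 \<le> (\<Sum>x\<in>X. a x * u x))"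
  using assms
proof (induction arbitrary: F rule: finite_ne_induct)
  case (singleton x)
  then show ?case by (intro exI[of _ "\<lambda>_. 1"]) (auto simp: not_less)
next
  case (insert x X)
  let ?F = "{u \<in> F. u x < 0}"
  have "(\<lambda>y. \<alpha> * u y + (1 - \<alpha>) * v y) \<in> ?F" if "u \<in> ?F" "v \<in> ?F" "0 \<le> \<alpha>" "\<alpha> \<le> 1" for u v \<alpha>
  proof -
    have "\<alpha> * u x + (1 - \<alpha>) * v x < 0"
      using that convex_bound_lt[of "u x" 0 "v x" \<alpha> "1 - \<alpha>"] by auto
    with that insert.prems(1) show ?thesis by auto
  qed
  moreover have "\<not> (\<exists>u\<in>?F. \<forall>y\<in>X. u y < 0)"
    using insert.prems(2) by auto
  ultimately obtain a where a: "\<forall>y\<in>X. 0 \<le> a y" "sum a X = 1"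
    and aF: "\<forall>u\<in>?F. 0 \<le> (\<Sum>y\<in>X. a y * u y)"
    using insert.IH[of ?F] by blast
  let ?L = "\<lambda>u. (u x, \<Sum>y\<in>X. a y * u y)"
  have "convex (?L ` F)"
  proof (rule convexI)
    fix p q :: "real \<times> real" and \<alpha> \<beta> :: real
    assume p: "p \<in> ?L ` F" and q: "q \<in> ?L ` F" and \<alpha>: "0 \<le> \<alpha>" "0 \<le> \<beta>" "\<alpha> + \<beta> = 1"
    from p q obtain u v where u: "u \<in> F" "p = ?L u" and v: "v \<in> F" "q = ?L v" by auto
    have "\<beta> = 1 - \<alpha>" using \<alpha> by simp
    have "?L (\<lambda>y. \<alpha> * u y + (1 - \<alpha>) * v y) = \<alpha> *\<^sub>R p + \<beta> *\<^sub>R q"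
      unfolding u v \<open>\<beta> = 1 - \<alpha>\<close>
      by (simp add: sum_distrib_left distrib_left sum.distrib mult.left_commute)
    moreover have "(\<lambda>y. \<alpha> * u y + (1 - \<alpha>) * v y) \<in> F"
      using insert.prems(1) u v \<alpha> by auto
    ultimately show "\<alpha> *\<^sub>R p + \<beta> *\<^sub>R q \<in> ?L ` F" by (intro image_eqI[where f = ?L, OF sym])
  qed
  moreover have "\<not> (\<exists>p q. (p, q) \<in> ?L ` F \<and> p < 0 \<and> q < 0)"
    using aF by fastforce
  ultimately obtain \<alpha> where \<alpha>: "0 \<le> \<alpha>" "\<alpha> \<le> 1"
    and pos: "\<And>p q. (p, q) \<in> ?L ` F \<Longrightarrow> 0 \<le> \<alpha> * p + (1 - \<alpha>) * q"
    by (rule convex_plane_alternative) blast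
  let ?b = "\<lambda>y. if y = x then \<alpha> else (1 - \<alpha>) * a y"
  have split: "(\<Sum>y\<in>insert x X. ?b y * u y) = \<alpha> * u x + (1 - \<alpha>) * (\<Sum>y\<in>X. a y * u y)" for u
  proof -
    have "(\<Sum>y\<in>X. ?b y * u y) = (\<Sum>y\<in>X. (1 - \<alpha>) * (a y * u y))"
      using insert.hyps by (intro sum.cong) auto
    then show ?thesis using insert.hyps by (simp add: sum_distrib_left)
  qed
  show ?case
  proof (intro exI[of _ ?b] conjI ballI)
    show "0 \<le> ?b y" if "y \<in> insert x X" for y using that a \<alpha> by auto
    show "sum ?b (insert x X) = 1" using split[of "\<lambda>_. 1"] a by simp
    show "0 \<le> (\<Sum>y\<in>insert x X. ?b y * u y)" if "u \<in> F" for u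
      unfolding split using pos that by blast
  qed
qed

subsection \<open>Forecasts and their amplification\<close>

text \<open>
  A forecast tree ends in an estimate of the square root of the likelihood ratio of the value
  \<open>True\<close> against \<open>False\<close>.
\<close>

datatype 'j forecast = Estimate real | Probe 'j "'j forecast" "'j forecast"

primrec estimate :: "'j forecast \<Rightarrow> ('j \<Rightarrow> bool) \<Rightarrow> real" where
  "estimate (Estimate r) y = r"
| "estimate (Probe j t0 t1) y = (if y j then estimate t1 y else estimate t0 y)"

primrec probes :: "'j forecast \<Rightarrow> ('j \<Rightarrow> bool) \<Rightarrow> nat" where
  "probes (Estimate r) y = 0"
| "probes (Probe j t0 t1) y = Suc (if y j then probes t1 y else probes t0 y)"

primrec forecast_within :: "'j set \<Rightarrow> 'j forecast \<Rightarrow> nat \<Rightarrow> bool" where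
  "forecast_within J (Estimate r) d \<longleftrightarrow> r > 0"
| "forecast_within J (Probe j t0 t1) d \<longleftrightarrow>
    j \<in> J \<and> d > 0 \<and> forecast_within J t0 (d - 1) \<and> forecast_within J t1 (d - 1)"

lemma forecast_within_mono: "forecast_within J t d \<Longrightarrow> d \<le> e \<Longrightarrow> forecast_within J t e"
proof (induction t arbitrary: d e)
  case (Probe j t0 t1)
  then show ?case using diff_le_mono[of d e 1] by fastforce
qed simp

lemma estimate_pos: "forecast_within J t d \<Longrightarrow> estimate t y > 0"
  by (induction t arbitrary: d) auto

lemma probes_le: "forecast_within J t d \<Longrightarrow> probes t y \<le> d"
proof (induction t arbitrary: d)
  case (Probe j t0 t1)
  then have "probes t0 y \<le> d - 1" "probes t1 y \<le> d - 1" "d > 0" by auto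
  then show ?case by auto
qed simp

section \<open>Losses of forecasts and sequential runs\<close>

definition penalty :: "bool \<Rightarrow> real \<Rightarrow> real" where
  "penalty b r = (if b then 1 / r else r)"

lemma penalty_mult: "penalty b (r * s) = penalty b r * penalty b s"
  by (simp add: penalty_def)

lemma penalty_pos: "r > 0 \<Longrightarrow> penalty b r > 0"
  by (simp add: penalty_def)

lemma wrong_guess_le_penalty: "r > 0 \<Longrightarrow> of_bool ((r \<ge> 1) \<noteq> b) \<le> penalty b r"
  by (auto simp: penalty_def)

definition loss :: "real \<Rightarrow> bool \<Rightarrow> 'j forecast \<Rightarrow> ('j \<Rightarrow> bool) \<Rightarrow> real" where
  "loss \<beta> b t y = \<beta> ^ probes t y * penalty b (estimate t y)"

text \<open>\<open>k\<close> is a continuation that receives the remaining budget and the updated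
  product of estimates. Truncated subtraction leaves budget 0 after an overrun.\<close>

primrec graft :: "(nat \<Rightarrow> real \<Rightarrow> 'j dtree) \<Rightarrow> 'j forecast \<Rightarrow> nat \<Rightarrow> real \<Rightarrow> 'j dtree" where
  "graft k (Estimate l) s r = k s (r * l)"
| "graft k (Probe j t0 t1) s r = Query j (graft k t0 (s - 1) r) (graft k t1 (s - 1) r)"

text \<open>
  The budget \<open>s\<close> is only tested between forecasts, so the last one may overrun it; \<open>r\<close> is the
  product of the estimates so far.
\<close>

primrec run_forecasts :: "'j forecast list \<Rightarrow> nat \<Rightarrow> real \<Rightarrow> 'j dtree" where
  "run_forecasts [] s r = Leaf (r \<ge> 1)"
| "run_forecasts (t # ts) s r =
    (if s = 0 then Leaf (r \<ge> 1) else graft (run_forecasts ts) t s r)"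

lemma dtree_output_graft:
  "dtree_output (graft k t s r) y = dtree_output (k (s - probes t y) (r * estimate t y)) y"
  by (induction t arbitrary: s) auto

lemma dtree_queries_graft:
  "dtree_queries (graft k t s r) y =
    probes t y + dtree_queries (k (s - probes t y) (r * estimate t y)) y"
  by (induction t arbitrary: s) auto

lemma set_dtree_graft:
  "forecast_within J t d \<Longrightarrow> (\<And>s r. set_dtree (k s r) \<subseteq> J) \<Longrightarrow> set_dtree (graft k t s r) \<subseteq> J"
  by (induction t arbitrary: s d) (simp, fastforce)

lemma set_dtree_run_forecasts:
  "\<forall>t\<in>set ts. forecast_within J t d \<Longrightarrow> set_dtree (run_forecasts ts s r) \<subseteq> J"
proof (induction ts arbitrary: s r)
  case (Cons t ts)
  then show ?case using set_dtree_graft[of J t d "run_forecasts ts"] by simp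
qed simp

text \<open>The last forecast starts with a positive budget, hence after at most
  \<open>s - 1\<close> queries, and adds at most \<open>d\<close> more.\<close>

lemma dtree_queries_run_forecasts:
  assumes "\<forall>t\<in>set ts. forecast_within J t d"
  shows "dtree_queries (run_forecasts ts s r) y \<le> (if s = 0 then 0 else s - 1 + d)"
  using assms
proof (induction ts arbitrary: s r)
  case (Cons t ts)
  let ?c = "probes t y"
  have "?c \<le> d" using Cons.prems by (auto intro: probes_le)
  moreover have "dtree_queries (run_forecasts ts (s - ?c) (r * estimate t y)) y
      \<le> (if s - ?c = 0 then 0 else s - ?c - 1 + d)"
    using Cons.prems by (intro Cons.IH) simp
  ultimately have "s > 0 \<Longrightarrow>
      ?c + dtree_queries (run_forecasts ts (s - ?c) (r * estimate t y)) y \<le> s - 1 + d"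
    by (auto split: if_splits)
  then show ?case by (simp add: dtree_queries_graft)
qed simp

primrec iid_list :: "nat \<Rightarrow> 'a pmf \<Rightarrow> 'a list pmf" where
  "iid_list 0 p = return_pmf []"
| "iid_list (Suc N) p = bind_pmf p (\<lambda>t. map_pmf ((#) t) (iid_list N p))"

lemma set_iid_list: "ts \<in> set_pmf (iid_list N p) \<Longrightarrow> set ts \<subseteq> set_pmf p"
  by (induction N arbitrary: ts) fastforce+

lemma finite_set_iid_list: "finite (set_pmf p) \<Longrightarrow> finite (set_pmf (iid_list N p))"
  by (induction N) auto

lemma expectation_iid_list_Suc:
  fixes h :: "'a list \<Rightarrow> real"
  assumes "finite (set_pmf p)"
  shows "measure_pmf.expectation (iid_list (Suc N) p) h =
    (\<Sum>t\<in>set_pmf p. pmf p t * measure_pmf.expectation (iid_list N p) (\<lambda>ts. h (t # ts)))"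
  using assms
  by (simp add: pmf_expectation_bind[of "set_pmf p"] finite_set_iid_list)

text \<open>A run stops because the budget is spent or because the list is exhausted, which accounts
  for the two terms. Induction on \<open>N\<close>: a forecast with \<open>c\<close> probes lowers
  the budget by \<open>c\<close> and so raises the bound by a factor of at most
  \<open>\<beta> ^ c\<close>; this factor times the penalty is the loss, whose mean is at most
  \<open>q\<close>.\<close>

lemma error_run_forecasts:
  assumes fin: "finite (set_pmf p)" and within: "\<And>t. t \<in> set_pmf p \<Longrightarrow> forecast_within J t d"
    and "\<beta> \<ge> 1" and "0 \<le> q" and loss: "(\<Sum>t\<in>set_pmf p. pmf p t * loss \<beta> b t y) \<le> q" and "q \<le> 1"
    and "r > 0"
  shows "measure_pmf.expectation (iid_list N p)
      (\<lambda>ts. of_bool (dtree_output (run_forecasts ts s r) y \<noteq> b)) \<le> penalty b r * ((1 / \<beta>) ^ s + q ^ N)"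
  using \<open>r > 0\<close>
proof (induction N arbitrary: s r)
  case 0
  have "of_bool ((r \<ge> 1) \<noteq> b) \<le> penalty b r * 1" using wrong_guess_le_penalty[OF 0] by simp
  also have "\<dots> \<le> penalty b r * ((1 / \<beta>) ^ s + 1)"
    using \<open>\<beta> \<ge> 1\<close> penalty_pos[OF 0, of b] by (intro mult_left_mono) auto
  finally show ?case by simp
next
  case (Suc N)
  note r = penalty_pos[OF Suc.prems, of b]
  show ?case
  proof (cases "s = 0")
    case True
    have "measure_pmf.expectation (iid_list (Suc N) p)
        (\<lambda>ts. of_bool (dtree_output (run_forecasts ts s r) y \<noteq> b)) = (of_bool ((r \<ge> 1) \<noteq> b) :: real)"
    proof -
      have "dtree_output (run_forecasts ts s r) y = (r \<ge> 1)" for ts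
        using True by (cases ts) auto
      then show ?thesis by simp
    qed
    also have "\<dots> \<le> penalty b r * 1" using wrong_guess_le_penalty[OF Suc.prems] by simp
    also have "\<dots> \<le> penalty b r * (1 + q ^ Suc N)"
      using \<open>0 \<le> q\<close> r by (intro mult_left_mono) auto
    finally show ?thesis using True by simp
  next
    case False
    have step: "measure_pmf.expectation (iid_list N p)
        (\<lambda>ts. of_bool (dtree_output (run_forecasts (t # ts) s r) y \<noteq> b))
        \<le> penalty b r * (((1 / \<beta>) ^ s + q ^ N) * loss \<beta> b t y)" (is "?E \<le> _")
      if t: "t \<in> set_pmf p" for t
    proof -
      let ?c = "probes t y" and ?l = "estimate t y"
      have l: "?l > 0" using within[OF t] by (rule estimate_pos)
      have "?E \<le> penalty b (r * ?l) * ((1 / \<beta>) ^ (s - ?c) + q ^ N)"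
        using Suc.IH[of "r * ?l" "s - ?c"] Suc.prems l False by (simp add: dtree_output_graft)
      also have "\<dots> \<le> penalty b (r * ?l) * (\<beta> ^ ?c * ((1 / \<beta>) ^ s + q ^ N))"
      proof (rule mult_left_mono)
        \<comment> \<open>If \<open>?c\<close> exceeds \<open>s\<close>, the remaining budget is
          truncated to 0 and the left side is 1, still at most
          \<open>\<beta> ^ (?c - s)\<close>.\<close>
        have "(1 / \<beta>) ^ (s - ?c) \<le> \<beta> ^ ?c * (1 / \<beta>) ^ s"
        proof (cases "?c \<le> s")
          case True
          then have "(1 / \<beta>) ^ s = (1 / \<beta>) ^ (s - ?c) * (1 / \<beta>) ^ ?c"
            by (simp flip: power_add)
          then show ?thesis using \<open>\<beta> \<ge> 1\<close> by (simp add: power_divide)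
        next
          case False
          then have "\<beta> ^ s \<le> \<beta> ^ ?c" using \<open>\<beta> \<ge> 1\<close> by (intro power_increasing) auto
          then show ?thesis using \<open>\<beta> \<ge> 1\<close> False by (simp add: power_divide)
        qed
        moreover have "q ^ N \<le> \<beta> ^ ?c * q ^ N"
          using \<open>\<beta> \<ge> 1\<close> \<open>0 \<le> q\<close> mult_right_mono[of 1 "\<beta> ^ ?c" "q ^ N"] by simp
        ultimately show "(1 / \<beta>) ^ (s - ?c) + q ^ N \<le> \<beta> ^ ?c * ((1 / \<beta>) ^ s + q ^ N)"
          by (simp add: algebra_simps)
        show "0 \<le> penalty b (r * ?l)" using penalty_pos[of "r * ?l" b] Suc.prems l by simp
      qed
      also have "\<dots> = penalty b r * (((1 / \<beta>) ^ s + q ^ N) * loss \<beta> b t y)"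
        by (simp add: penalty_mult loss_def)
      finally show ?thesis .
    qed
    have "measure_pmf.expectation (iid_list (Suc N) p)
        (\<lambda>ts. of_bool (dtree_output (run_forecasts ts s r) y \<noteq> b))
        \<le> (\<Sum>t\<in>set_pmf p. pmf p t * (penalty b r * (((1 / \<beta>) ^ s + q ^ N) * loss \<beta> b t y)))"
      unfolding expectation_iid_list_Suc[OF fin]
      by (intro sum_mono mult_left_mono step) auto
    also have "\<dots> = penalty b r * (((1 / \<beta>) ^ s + q ^ N) * (\<Sum>t\<in>set_pmf p. pmf p t * loss \<beta> b t y))"
      by (simp add: sum_distrib_left mult_ac)
    also have "\<dots> \<le> penalty b r * (((1 / \<beta>) ^ s + q ^ N) * q)"
      using loss r \<open>\<beta> \<ge> 1\<close> \<open>0 \<le> q\<close> by (intro mult_left_mono) auto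
    \<comment> \<open>The factor \<open>q\<close> is given away in the budget term and kept in the
      other.\<close>
    also have "\<dots> \<le> penalty b r * ((1 / \<beta>) ^ s + q ^ Suc N)"
    proof -
      have "(1 / \<beta>) ^ s * q \<le> (1 / \<beta>) ^ s * 1" using \<open>\<beta> \<ge> 1\<close> \<open>q \<le> 1\<close> by (intro mult_left_mono) auto
      then show ?thesis using r by (intro mult_left_mono) (auto simp: algebra_simps)
    qed
    finally show ?thesis .
  qed
qed

text \<open>The query bound depends on \<open>s\<close> and \<open>d\<close> only, so the number
  \<open>N\<close> of independent copies may be as large as it takes to push the error below
  1/3.\<close>

lemma rand_query_le_if_forecast:
  assumes dom: "finite (dom g)"
    and fin: "finite (set_pmf p)" and within: "\<And>t. t \<in> set_pmf p \<Longrightarrow> forecast_within J t d"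
    and "\<beta> \<ge> 1" and "\<beta> ^ s > 3"
    and loss: "\<And>y. y \<in> dom g \<Longrightarrow> measure_pmf.expectation p (\<lambda>t. loss \<beta> (the (g y)) t y) < 1"
  shows "rand_query J g \<le> s - 1 + d"
proof -
  let ?u = "\<lambda>y. \<Sum>t\<in>set_pmf p. pmf p t * loss \<beta> (the (g y)) t y"
  \<comment> \<open>Finiteness of the domain turns the pointwise strict bounds into one
    \<open>q < 1\<close>. Inserting 0 makes \<open>q\<close> nonnegative and keeps the maximum
    meaningful on an empty domain.\<close>
  define q where "q = Max (insert 0 (?u ` dom g))"
  have u: "measure_pmf.expectation p (\<lambda>t. loss \<beta> (the (g y)) t y) = ?u y" for y
    by (subst integral_measure_pmf_real[OF fin]) (auto simp: mult.commute)
  have "0 \<le> q" and uq: "\<And>y. y \<in> dom g \<Longrightarrow> ?u y \<le> q"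
    unfolding q_def using dom by (auto intro: Max_ge)
  have "q < 1" unfolding q_def using dom loss by (auto simp: u)
  have "s > 0" using \<open>\<beta> ^ s > 3\<close> by (cases s) auto
  have "(1 / \<beta>) ^ s < 1 / 3" using \<open>\<beta> ^ s > 3\<close> by (simp add: power_divide field_simps)
  moreover have "(\<lambda>N. q ^ N) \<longlonglongrightarrow> 0" using \<open>0 \<le> q\<close> \<open>q < 1\<close> by (intro LIMSEQ_power_zero) auto
  ultimately have "\<forall>\<^sub>F N in sequentially. q ^ N < 1 / 3 - (1 / \<beta>) ^ s"
    by (intro order_tendstoD(2)[where y = 0]) auto
  then obtain N where N: "q ^ N < 1 / 3 - (1 / \<beta>) ^ s" by (auto simp: eventually_sequentially)
  define D where "D = map_pmf (\<lambda>ts. run_forecasts ts s 1) (iid_list N p)"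
  have ts: "\<forall>t\<in>set ts. forecast_within J t d" if "ts \<in> set_pmf (iid_list N p)" for ts
    using set_iid_list[OF that] within by auto
  have "queries_at_most J D (s - 1 + d)"
    using set_dtree_run_forecasts[OF ts] dtree_queries_run_forecasts[OF ts, of _ s 1] \<open>s > 0\<close>
    by (fastforce simp: queries_at_most_def D_def)
  moreover have "computes D g"
    unfolding computes_def
  proof
    fix y assume y: "y \<in> dom g"
    then obtain b where b: "g y = Some b" by auto
    let ?A = "{ts. dtree_output (run_forecasts ts s 1) y = b}"
    have "measure_pmf.prob (iid_list N p) (- ?A) = measure_pmf.expectation (iid_list N p)
      (\<lambda>ts. of_bool (dtree_output (run_forecasts ts s 1) y \<noteq> b))"
    proof -
      have "(\<lambda>ts. of_bool (dtree_output (run_forecasts ts s 1) y \<noteq> b)) = (indicator (- ?A) :: _ \<Rightarrow> real)"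
        by (auto simp: indicator_def)
      then show ?thesis by simp
    qed
    also have "\<dots> \<le> penalty b 1 * ((1 / \<beta>) ^ s + q ^ N)"
      using uq[OF y] \<open>0 \<le> q\<close> \<open>q < 1\<close> \<open>\<beta> \<ge> 1\<close> b
      by (intro error_run_forecasts[OF fin within]) auto
    also have "\<dots> \<le> 1 / 3" using N by (simp add: penalty_def)
    finally have "measure_pmf.prob (iid_list N p) ?A \<ge> 2 / 3"
      using measure_pmf.prob_compl[of ?A "iid_list N p"] by (simp add: Compl_eq_Diff_UNIV)
    then show "2 / 3 \<le> measure_pmf.prob D {t. Some (dtree_output t y) = g y}"
      by (simp add: D_def b vimage_def)
  qed
  ultimately show ?thesis unfolding rand_query_def by (intro Least_le) auto
qed

subsection \<open>A hard pair of distributions\<close>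

lemma loss_pos: "\<beta> > 0 \<Longrightarrow> forecast_within J t d \<Longrightarrow> loss \<beta> b t y > 0"
  by (simp add: loss_def penalty_pos estimate_pos)

lemma rand_query_eq_0: "dom g = {} \<Longrightarrow> rand_query J g = 0"
proof -
  assume "dom g = {}"
  then have "queries_at_most J (return_pmf (Leaf True)) 0 \<and> computes (return_pmf (Leaf True)) g"
    by (simp add: queries_at_most_def computes_def)
  then have "rand_query J g \<le> 0" unfolding rand_query_def by (intro Least_le) blast
  then show ?thesis by simp
qed

text \<open>Minimax for the functions "expected loss minus 1" of finitely supported random
  forecasts. If one of them were negative on all inputs, \<open>rand_query_le_if_forecast\<close>
  would contradict \<open>hard\<close>. The weights obtained are then tested on point
  masses.\<close>

lemma hard_weights:
  fixes g :: "('j \<Rightarrow> bool) \<Rightarrow> bool option"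
  assumes dom: "finite (dom g)" and "\<beta> \<ge> 1" "\<beta> ^ s > 3"
    and hard: "s - 1 + d < rand_query J g"
  obtains a :: "('j \<Rightarrow> bool) \<Rightarrow> real" where
    "\<And>y. y \<in> dom g \<Longrightarrow> 0 \<le> a y" "sum a (dom g) = 1"
    "\<And>t. forecast_within J t d \<Longrightarrow> 1 \<le> (\<Sum>y\<in>dom g. a y * loss \<beta> (the (g y)) t y)"
proof -
  let ?e = "\<lambda>p y. measure_pmf.expectation p (\<lambda>t. loss \<beta> (the (g y)) t y)"
  let ?P = "{p. finite (set_pmf p) \<and> (\<forall>t\<in>set_pmf p. forecast_within J t d)}"
  let ?F = "(\<lambda>p y. ?e p y - 1) ` ?P"
  have "dom g \<noteq> {}" using hard rand_query_eq_0[of g J] by auto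
  moreover have "(\<lambda>y. \<alpha> * u y + (1 - \<alpha>) * v y) \<in> ?F"
    if u: "u \<in> ?F" and v: "v \<in> ?F" and \<alpha>: "0 \<le> \<alpha>" "\<alpha> \<le> 1" for u v \<alpha>
  proof -
    from u v obtain p q where p: "p \<in> ?P" "u = (\<lambda>y. ?e p y - 1)" and q: "q \<in> ?P" "v = (\<lambda>y. ?e q y - 1)"
      by blast
    \<comment> \<open>A biased coin that selects \<open>p\<close> or \<open>q\<close> realises the
      convex combination.\<close>
    let ?r = "bind_pmf (bernoulli_pmf \<alpha>) (\<lambda>b. if b then p else q)"
    have "?r \<in> ?P" using p(1) q(1) by (auto split: if_splits)
    moreover have "?e ?r y = \<alpha> * ?e p y + (1 - \<alpha>) * ?e q y" for y
      using p(1) q(1) \<alpha> by (subst pmf_expectation_bind[of UNIV]) (auto simp: UNIV_bool)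
    then have "(\<lambda>y. \<alpha> * u y + (1 - \<alpha>) * v y) = (\<lambda>y. ?e ?r y - 1)"
      unfolding p(2) q(2) by (auto simp: algebra_simps)
    ultimately show ?thesis by blast
  qed
  moreover have "\<not> (\<exists>u\<in>?F. \<forall>y\<in>dom g. u y < 0)"
  proof
    assume "\<exists>u\<in>?F. \<forall>y\<in>dom g. u y < 0"
    then obtain p where "p \<in> ?P" "\<And>y. y \<in> dom g \<Longrightarrow> ?e p y < 1" by auto
    then have "rand_query J g \<le> s - 1 + d"
      using assms by (intro rand_query_le_if_forecast[of g p J d \<beta> s]) auto
    with hard show False by simp
  qed
  ultimately obtain a where a: "\<forall>y\<in>dom g. 0 \<le> a y" "sum a (dom g) = 1"
    and pos: "\<forall>u\<in>?F. 0 \<le> (\<Sum>y\<in>dom g. a y * u y)"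
    using convex_functions_alternative[of "dom g" ?F] dom by auto
  have "1 \<le> (\<Sum>y\<in>dom g. a y * loss \<beta> (the (g y)) t y)" if t: "forecast_within J t d" for t
  proof -
    have "return_pmf t \<in> ?P" using t by simp
    then have "0 \<le> (\<Sum>y\<in>dom g. a y * (?e (return_pmf t) y - 1))" by (intro bspec[OF pos] imageI)
    also have "\<dots> = (\<Sum>y\<in>dom g. a y * loss \<beta> (the (g y)) t y) - sum a (dom g)"
      by (simp add: algebra_simps sum_subtractf)
    finally show ?thesis using a by simp
  qed
  with a that show thesis by blast
qed

text \<open>For positive \<open>u\<close> and \<open>v\<close> the choice
  \<open>r = sqrt (v / u)\<close> minimises the bound. If one of them vanishes, the infimum 0 need
  not be attained, hence the argument up to an arbitrary \<open>e\<close>.\<close>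

lemma le_geometric_mean:
  fixes u v w :: real
  assumes "0 \<le> u" "0 \<le> v" and le: "\<And>r. r > 0 \<Longrightarrow> w \<le> u * r + v / r"
  shows "w \<le> 2 * sqrt (u * v)"
proof (rule field_le_epsilon)
  fix e :: real assume "e > 0"
  show "w \<le> 2 * sqrt (u * v) + e"
  proof (cases "u = 0 \<or> v = 0")
    case True
    define r where "r = (if u = 0 then (v + 1) / e else e / u)"
    have "r > 0" using assms \<open>e > 0\<close> by (auto simp: r_def intro: divide_pos_pos add_nonneg_pos)
    moreover have "u * r + v / r \<le> e"
      using True assms(1,2) \<open>e > 0\<close> by (auto simp: r_def field_simps)
    ultimately show ?thesis using le[of r] True by auto
  next
    case False
    then have "u > 0" "v > 0" using assms by auto
    then have "u * sqrt (v / u) + v / sqrt (v / u) = 2 * sqrt (u * v)"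
      by (simp add: real_sqrt_divide real_sqrt_mult field_simps)
    then show ?thesis using le[of "sqrt (v / u)"] \<open>u > 0\<close> \<open>v > 0\<close> \<open>e > 0\<close> by simp
  qed
qed

text \<open>\<open>V e \<sigma>\<close> is the infimum of the weighted loss on
  \<open>\<sigma>\<close> over forecasts of depth \<open>e\<close>. Constant forecasts yield the
  bound by the geometric mean, and forecasts that begin with a probe of \<open>j\<close> yield the
  step inequality.\<close>

lemma hard_pair:
  fixes g :: "('j \<Rightarrow> bool) \<Rightarrow> bool option"
  assumes dom: "finite (dom g)" and \<beta>: "\<beta> \<ge> 1" "\<beta> ^ s > 3"
    and hard: "s - 1 + d < rand_query J g"
  obtains p :: "bool \<Rightarrow> ('j \<Rightarrow> bool) \<Rightarrow> real" and V :: "nat \<Rightarrow> ('j \<Rightarrow> bool) set \<Rightarrow> real" where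
    "\<And>b y. 0 \<le> p b y" "\<And>b y. p b y \<noteq> 0 \<Longrightarrow> g y = Some b" "\<And>b. sum (p b) (dom g) = 1"
    "\<And>e \<sigma>. \<sigma> \<subseteq> dom g \<Longrightarrow> 0 \<le> V e \<sigma>"
    "\<And>e \<sigma>. \<sigma> \<subseteq> dom g \<Longrightarrow> V e \<sigma> \<le> sqrt (sum (p False) \<sigma> * sum (p True) \<sigma>)"
    "\<And>e \<sigma>. \<sigma> \<subseteq> dom g \<Longrightarrow> V (Suc e) \<sigma> \<le> V e \<sigma>"
    "\<And>e \<sigma> j. j \<in> J \<Longrightarrow> \<sigma> \<subseteq> dom g \<Longrightarrow> V (Suc e) \<sigma> \<le> \<beta> * (V e {y\<in>\<sigma>. \<not> y j} + V e {y\<in>\<sigma>. y j})"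
    "1 \<le> V d (dom g)"
proof -
  obtain a where a: "\<And>y. y \<in> dom g \<Longrightarrow> 0 \<le> a y" "sum a (dom g) = 1"
    and a_loss: "\<And>t. forecast_within J t d \<Longrightarrow> 1 \<le> (\<Sum>y\<in>dom g. a y * loss \<beta> (the (g y)) t y)"
    using hard_weights[OF assms] by blast
  \<comment> \<open>With the factor 2 the total masses for the two values of \<open>b\<close> sum to
    2; that each of them is 1 is shown in \<open>p_1\<close>.\<close>
  define p where "p b y = (if g y = Some b then 2 * a y else 0)" for b y
  define L where "L \<sigma> t = (\<Sum>y\<in>\<sigma>. a y * loss \<beta> (the (g y)) t y)" for \<sigma> t
  define W where "W e = {t. forecast_within J t e}" for e
  define V where "V e \<sigma> = (INF t\<in>W e. L \<sigma> t)" for e \<sigma>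
  have p_nonneg: "0 \<le> p b y" for b y using a by (auto simp: p_def dom_def)
  have L_nonneg: "0 \<le> L \<sigma> t" if "\<sigma> \<subseteq> dom g" "t \<in> W e" for e \<sigma> t
  proof -
    have "0 \<le> loss \<beta> b t y" for b y
      using that loss_pos[of \<beta> J t e] \<beta> by (force simp: W_def intro: less_imp_le)
    then show ?thesis
      unfolding L_def using that a(1) by (intro sum_nonneg mult_nonneg_nonneg) blast+
  qed
  have W_ne: "Estimate 1 \<in> W e" for e by (simp add: W_def)
  have bdd: "bdd_below (L \<sigma> ` W e)" if "\<sigma> \<subseteq> dom g" for e \<sigma>
    using L_nonneg[OF that] by (auto intro: bdd_belowI[of _ 0])
  have V_le: "V e \<sigma> \<le> L \<sigma> t" if "\<sigma> \<subseteq> dom g" "t \<in> W e" for e \<sigma> t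
    unfolding V_def using that bdd by (intro cINF_lower) auto
  have le_V: "c \<le> V e \<sigma>" if "\<And>t. t \<in> W e \<Longrightarrow> c \<le> L \<sigma> t" for c e \<sigma>
    unfolding V_def using that W_ne[of e] by (intro cINF_greatest) auto
  have W_Suc: "W e \<subseteq> W (Suc e)" for e by (auto simp: W_def intro: forecast_within_mono)
  have L_Estimate: "L \<sigma> (Estimate r) = sum (p False) \<sigma> / 2 * r + sum (p True) \<sigma> / 2 / r"
    if "\<sigma> \<subseteq> dom g" for \<sigma> r
    unfolding L_def sum_divide_distrib sum_distrib_right sum.distrib[symmetric]
    using that by (intro sum.cong) (auto simp: loss_def penalty_def p_def)
  have V_gm: "V e \<sigma> \<le> sqrt (sum (p False) \<sigma> * sum (p True) \<sigma>)" if "\<sigma> \<subseteq> dom g" for e \<sigma>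
  proof -
    have "V e \<sigma> \<le> 2 * sqrt (sum (p False) \<sigma> / 2 * (sum (p True) \<sigma> / 2))"
    proof (rule le_geometric_mean)
      show "V e \<sigma> \<le> sum (p False) \<sigma> / 2 * r + sum (p True) \<sigma> / 2 / r" if "r > 0" for r
        using V_le[of \<sigma> "Estimate r" e] \<open>\<sigma> \<subseteq> dom g\<close> that L_Estimate[of \<sigma> r] by (simp add: W_def)
    qed (auto intro: sum_nonneg p_nonneg)
    also have "\<dots> = sqrt (sum (p False) \<sigma> * sum (p True) \<sigma>)"
      by (simp add: real_sqrt_divide real_sqrt_mult)
    finally show ?thesis .
  qed
  have V_Suc: "V (Suc e) \<sigma> \<le> V e \<sigma>" if "\<sigma> \<subseteq> dom g" for e \<sigma>
    using V_le[OF that] W_Suc by (intro le_V) auto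
  have V_step: "V (Suc e) \<sigma> \<le> \<beta> * (V e {y\<in>\<sigma>. \<not> y j} + V e {y\<in>\<sigma>. y j})"
    if "j \<in> J" and \<sigma>: "\<sigma> \<subseteq> dom g" for e \<sigma> j
  proof -
    let ?\<sigma>0 = "{y\<in>\<sigma>. \<not> y j}" and ?\<sigma>1 = "{y\<in>\<sigma>. y j}"
    have *: "V (Suc e) \<sigma> / \<beta> \<le> L ?\<sigma>0 t0 + L ?\<sigma>1 t1" if t: "t0 \<in> W e" "t1 \<in> W e" for t0 t1
    proof -
      have "V (Suc e) \<sigma> \<le> L \<sigma> (Probe j t0 t1)"
        using t \<open>j \<in> J\<close> by (intro V_le \<sigma>) (auto simp: W_def)
      also have "\<dots> = L ?\<sigma>0 (Probe j t0 t1) + L ?\<sigma>1 (Probe j t0 t1)"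
        unfolding L_def using finite_subset[OF \<sigma> dom]
        by (subst sum.union_disjoint[symmetric]) (auto intro: sum.cong)
      also have "\<dots> = \<beta> * (L ?\<sigma>0 t0 + L ?\<sigma>1 t1)"
        by (auto simp: L_def loss_def distrib_left sum_distrib_left intro!: arg_cong2[of _ _ _ _ "(+)"] sum.cong)
      finally show ?thesis using \<beta> by (simp add: divide_le_eq mult.commute)
    qed
    \<comment> \<open>The infima are taken one after the other: over \<open>t0\<close> with
      \<open>t1\<close> fixed, then over \<open>t1\<close>.\<close>
    have "V (Suc e) \<sigma> / \<beta> - L ?\<sigma>1 t1 \<le> V e ?\<sigma>0" if "t1 \<in> W e" for t1
      using *[OF _ that] by (intro le_V) (simp add: algebra_simps)
    then have "V (Suc e) \<sigma> / \<beta> - V e ?\<sigma>0 \<le> V e ?\<sigma>1"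
      by (intro le_V) (simp add: algebra_simps)
    then show ?thesis using \<beta> by (simp add: field_simps)
  qed
  have V_1: "1 \<le> V d (dom g)" using a_loss by (intro le_V) (auto simp: W_def L_def)
  \<comment> \<open>Equality case of the AM-GM inequality: the masses have sum 2, and
    \<open>V_1\<close> with \<open>V_gm\<close> makes their product at least 1.\<close>
  have p_1: "sum (p b) (dom g) = 1" for b
  proof -
    let ?u = "sum (p False) (dom g)" and ?v = "sum (p True) (dom g)"
    have nn: "0 \<le> ?u" "0 \<le> ?v" using p_nonneg by (auto intro: sum_nonneg)
    have "?u + ?v = 2 * sum a (dom g)"
      unfolding sum_distrib_left sum.distrib[symmetric] by (intro sum.cong) (auto simp: p_def)
    then have "?u + ?v = 2" using a by simp
    moreover have "1 \<le> sqrt (?u * ?v)" using V_1 V_gm[of "dom g" d] by (rule order_trans) simp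
    then have "1 \<le> ?u * ?v" by simp
    moreover have "(?u - ?v)^2 = (?u + ?v)^2 - 4 * (?u * ?v)" by (simp add: power2_eq_square algebra_simps)
    ultimately have "(?u - ?v)^2 \<le> 0" by simp
    then show ?thesis using \<open>?u + ?v = 2\<close> by (cases b) auto
  qed
  have V_nonneg: "0 \<le> V e \<sigma>" if "\<sigma> \<subseteq> dom g" for e \<sigma>
    using L_nonneg[OF that] by (intro le_V) auto
  have p_dom: "g y = Some b" if "p b y \<noteq> 0" for b y
    using that by (simp add: p_def split: if_splits)
  show thesis
    by (rule that[of p V]) (fact p_nonneg p_dom p_1 V_nonneg V_gm V_Suc V_step V_1)+
qed

subsection \<open>Affinity of composed inputs\<close>

text \<open>Cauchy-Schwarz in the plane, with the cross term bounded by AM-GM. It says that merging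
  two pieces of a space cannot lower the affinity.\<close>

lemma sqrt_mult_add_le:
  fixes a b c d :: real
  assumes "0 \<le> a" "0 \<le> b" "0 \<le> c" "0 \<le> d"
  shows "sqrt (a * c) + sqrt (b * d) \<le> sqrt ((a + b) * (c + d))"
proof (rule real_le_rsqrt)
  have "sqrt (a * c) * sqrt (b * d) = sqrt ((a * d) * (b * c))"
    by (simp add: mult_ac flip: real_sqrt_mult)
  also have "\<dots> \<le> (a * d + b * c) / 2" using assms by (intro arith_geo_mean_sqrt) auto
  finally show "(sqrt (a * c) + sqrt (b * d))\<^sup>2 \<le> (a + b) * (c + d)"
    using assms by (simp add: power2_sum algebra_simps)
qed

text \<open>The Bhattacharyya coefficient of two Bernoulli distributions against their total
  variation distance: AM-GM on the cross term leaves exactly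
  \<open>1 - (p - q)\<^sup>2\<close>.\<close>

lemma affinity_le:
  fixes p q :: real
  assumes "0 \<le> p" "p \<le> 1" "0 \<le> q" "q \<le> 1"
  shows "(sqrt (p * q) + sqrt ((1 - p) * (1 - q)))\<^sup>2 \<le> 1 - (p - q)\<^sup>2"
proof -
  have "sqrt (p * q) * sqrt ((1 - p) * (1 - q)) = sqrt ((p * (1 - p)) * (q * (1 - q)))"
    by (simp add: mult_ac flip: real_sqrt_mult)
  also have "\<dots> \<le> (p * (1 - p) + q * (1 - q)) / 2"
    using assms by (intro arith_geo_mean_sqrt) auto
  finally have "2 * (sqrt (p * q) * sqrt ((1 - p) * (1 - q))) \<le> p * (1 - p) + q * (1 - q)" by simp
  moreover have "(sqrt (p * q) + sqrt ((1 - p) * (1 - q)))\<^sup>2 =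
      p * q + (1 - p) * (1 - q) + 2 * (sqrt (p * q) * sqrt ((1 - p) * (1 - q)))"
    using assms by (simp add: power2_sum)
  ultimately show ?thesis by (simp add: power2_eq_square algebra_simps)
qed

lemma sqrt_prod: "sqrt (prod h A) = (\<Prod>x\<in>A. sqrt (h x))"
  by (induction A rule: infinite_finite_induct) (auto simp: real_sqrt_mult)

text \<open>The averaging direction of Yao's principle. Indices of weight 0 are exempt from the
  success guarantee, because they may stand for inputs outside the domain.\<close>

lemma exists_outcome_ge_average:
  fixes c :: "'k \<Rightarrow> real"
  assumes "finite K" "\<And>\<kappa>. \<kappa> \<in> K \<Longrightarrow> 0 \<le> c \<kappa>"
    and prob: "\<And>\<kappa>. \<kappa> \<in> K \<Longrightarrow> c \<kappa> \<noteq> 0 \<Longrightarrow> \<delta> \<le> measure_pmf.prob D {t. E \<kappa> t}"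
  shows "\<exists>t\<in>set_pmf D. \<delta> * sum c K \<le> (\<Sum>\<kappa>\<in>K. c \<kappa> * of_bool (E \<kappa> t))"
proof (rule ccontr)
  assume "\<not> ?thesis"
  then have less: "(\<Sum>\<kappa>\<in>K. c \<kappa> * of_bool (E \<kappa> t)) < \<delta> * sum c K" if "t \<in> set_pmf D" for t
    using that by (auto simp: not_le)
  have int: "integrable (measure_pmf D) (\<lambda>t. of_bool (E \<kappa> t) :: real)" for \<kappa>
    by (rule measure_pmf.integrable_const_bound[where B = 1]) auto
  have expectation: "measure_pmf.expectation D (\<lambda>t. of_bool (E \<kappa> t)) = measure_pmf.prob D {t. E \<kappa> t}" for \<kappa>
  proof -
    have "(\<lambda>t. of_bool (E \<kappa> t)) = (indicator {t. E \<kappa> t} :: _ \<Rightarrow> real)"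
      by (auto simp: indicator_def)
    then show ?thesis by simp
  qed
  have "measure_pmf.expectation D (\<lambda>t. \<Sum>\<kappa>\<in>K. c \<kappa> * of_bool (E \<kappa> t)) < \<delta> * sum c K"
  proof (rule measure_pmf.expectation_less)
    show "integrable (measure_pmf D) (\<lambda>t. \<Sum>\<kappa>\<in>K. c \<kappa> * of_bool (E \<kappa> t))"
      by (intro Bochner_Integration.integrable_sum integrable_mult_right int)
  qed (auto simp: AE_measure_pmf_iff less)
  also have "\<delta> * sum c K = (\<Sum>\<kappa>\<in>K. c \<kappa> * \<delta>)"
    by (simp add: sum_distrib_left mult.commute)
  also have "\<dots> \<le> (\<Sum>\<kappa>\<in>K. c \<kappa> * measure_pmf.prob D {t. E \<kappa> t})"
    using assms(2) prob by (intro sum_mono) (metis mult_left_mono mult_zero_left order_refl)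
  also have "\<dots> = measure_pmf.expectation D (\<lambda>t. \<Sum>\<kappa>\<in>K. c \<kappa> * of_bool (E \<kappa> t))"
    by (subst Bochner_Integration.integral_sum) (auto simp: int expectation)
  finally show False by simp
qed

section \<open>Composed inputs and queries inside a block\<close>

definition join_rows :: "'i set \<Rightarrow> 'j set \<Rightarrow> ('i \<Rightarrow> 'j \<Rightarrow> bool) \<Rightarrow> 'i \<times> 'j \<Rightarrow> bool" where
  "join_rows I J Z = (\<lambda>(i, j)\<in>I \<times> J. Z i j)"

lemma boolfun_comp_join_rows:
  assumes f: "partial_boolfun I f" and g: "partial_boolfun J g" and x: "x \<in> dom f"
    and Z: "\<And>i. i \<in> I \<Longrightarrow> g (Z i) = Some (x i)"
  shows "boolfun_comp I J f g (join_rows I J Z) = f x"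
proof -
  have "row J (join_rows I J Z) i = Z i" if "i \<in> I" for i
  proof -
    have "Z i \<in> cube J" using g Z[OF that] by (auto simp: partial_boolfun_def)
    then show ?thesis
      using that by (auto simp: row_def join_rows_def cube_def fun_eq_iff PiE_def extensional_def restrict_def)
  qed
  moreover have "x \<in> cube I" using f x by (auto simp: partial_boolfun_def)
  then have "(\<lambda>i\<in>I. x i) = x" by (auto simp: cube_def)
  moreover have "(\<lambda>i\<in>I. the (g (row J (join_rows I J Z) i))) = (\<lambda>i\<in>I. x i)"
    using calculation(1) Z by (intro restrict_ext) auto
  moreover have "join_rows I J Z \<in> cube (I \<times> J)" by (auto simp: join_rows_def cube_def)
  ultimately show ?thesis using Z by (auto simp: boolfun_comp_def)
qed

primrec block_queries :: "'i set \<Rightarrow> ('i \<times> 'j) dtree \<Rightarrow> ('i \<times> 'j \<Rightarrow> bool) \<Rightarrow> nat" where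
  "block_queries B (Leaf b) z = 0"
| "block_queries B (Query q t0 t1) z =
    of_bool (fst q \<in> B) + (if z q then block_queries B t1 z else block_queries B t0 z)"

text \<open>The budget \<open>d\<close> counts queries in the rows of \<open>B\<close> only; the run
  answers the default \<open>v\<close> as soon as it would make query number \<open>d + 1\<close>
  there.\<close>

primrec truncated_output ::
  "'i set \<Rightarrow> bool \<Rightarrow> ('i \<times> 'j) dtree \<Rightarrow> nat \<Rightarrow> ('i \<times> 'j \<Rightarrow> bool) \<Rightarrow> bool" where
  "truncated_output B v (Leaf b) d z = b"
| "truncated_output B v (Query q t0 t1) d z =
    (if fst q \<in> B \<and> d = 0 then v
     else (if z q then truncated_output B v t1 (d - of_bool (fst q \<in> B)) z
           else truncated_output B v t0 (d - of_bool (fst q \<in> B)) z))"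

lemma truncated_output_eq:
  "truncated_output B v t d z = (if block_queries B t z > d then v else dtree_output t z)"
  by (induction t arbitrary: d) auto

text \<open>Double counting: each query lies in one row, and by the packing constraint the blocks
  containing that row have total weight at most 1.\<close>

lemma weighted_block_queries_le:
  fixes w :: "'i set \<Rightarrow> real"
  assumes "finite \<B>" and w: "\<And>i. i \<in> I \<Longrightarrow> (\<Sum>B | B \<in> \<B> \<and> i \<in> B. w B) \<le> 1"
    and "set_dtree t \<subseteq> I \<times> J"
  shows "(\<Sum>B\<in>\<B>. w B * real (block_queries B t z)) \<le> real (dtree_queries t z)"
  using assms(3)
proof (induction t)
  case (Query q t0 t1)
  let ?t = "if z q then t1 else t0"
  have "(\<Sum>B\<in>\<B>. w B * real (block_queries B (Query q t0 t1) z)) =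
      (\<Sum>B\<in>\<B>. w B * of_bool (fst q \<in> B)) + (\<Sum>B\<in>\<B>. w B * real (block_queries B ?t z))"
    by (simp add: distrib_left sum.distrib)
  also have "(\<Sum>B\<in>\<B>. w B * of_bool (fst q \<in> B)) = (\<Sum>B | B \<in> \<B> \<and> fst q \<in> B. w B)"
    using \<open>finite \<B>\<close> by (simp add: of_bool_def if_distrib sum.If_cases Int_def cong: if_cong)
  also have "\<dots> \<le> 1" using Query.prems by (intro w) auto
  also have "(\<Sum>B\<in>\<B>. w B * real (block_queries B ?t z)) \<le> real (dtree_queries ?t z)"
    using Query by auto
  finally show ?case by (auto split: if_splits)
qed simp

section \<open>Product distributions over the rows\<close>

locale row_distributions =
  fixes I :: "'i set" and J :: "'j set" and X :: "('j \<Rightarrow> bool) set"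
    and p :: "bool \<Rightarrow> ('j \<Rightarrow> bool) \<Rightarrow> real"
  assumes finite_I: "finite I" and finite_X: "finite X" and p_nonneg: "0 \<le> p b y"
begin

definition weight :: "('i \<Rightarrow> bool) \<Rightarrow> ('i \<Rightarrow> 'j \<Rightarrow> bool) \<Rightarrow> real" where
  "weight x Z = (\<Prod>i\<in>I. p (x i) (Z i))"

text \<open>\<open>S\<close> is the rectangle of rows consistent with the answers so far. Leaving
  the mass unnormalised makes it additive when a query splits \<open>S\<close>.\<close>

definition mass ::
  "('i \<Rightarrow> bool) \<Rightarrow> ('i \<Rightarrow> ('j \<Rightarrow> bool) set) \<Rightarrow> (('i \<times> 'j \<Rightarrow> bool) \<Rightarrow> bool) \<Rightarrow> real" where
  "mass x S E = (\<Sum>Z\<in>PiE I S. weight x Z * of_bool (E (join_rows I J Z)))"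

text \<open>The Bhattacharyya coefficient of the output bit of \<open>h\<close> under the two row
  distributions, restricted to \<open>S\<close>.\<close>

definition affinity ::
  "('i \<Rightarrow> bool) \<Rightarrow> ('i \<Rightarrow> bool) \<Rightarrow> ('i \<Rightarrow> ('j \<Rightarrow> bool) set) \<Rightarrow> (('i \<times> 'j \<Rightarrow> bool) \<Rightarrow> bool) \<Rightarrow> real" where
  "affinity x x' S h =
    (\<Sum>b\<in>UNIV. sqrt (mass x S (\<lambda>z. h z = b) * mass x' S (\<lambda>z. h z = b)))"

lemma weight_nonneg: "0 \<le> weight x Z"
  by (simp add: weight_def p_nonneg prod_nonneg)

lemma mass_nonneg: "0 \<le> mass x S E"
  by (simp add: mass_def weight_nonneg sum_nonneg)

lemma finite_rows: "(\<And>i. i \<in> I \<Longrightarrow> S i \<subseteq> X) \<Longrightarrow> finite (PiE I S)"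
  by (intro finite_PiE finite_I) (auto intro: finite_subset[OF _ finite_X])

lemma mass_True:
  "(\<And>i. i \<in> I \<Longrightarrow> S i \<subseteq> X) \<Longrightarrow> mass x S (\<lambda>_. True) = (\<Prod>i\<in>I. sum (p (x i)) (S i))"
  unfolding mass_def weight_def
  by (simp add: finite_I prod_sum_PiE finite_subset[OF _ finite_X])

lemma mass_split:
  assumes S: "\<And>i. i \<in> I \<Longrightarrow> S i \<subseteq> X" and q: "i \<in> I" "j \<in> J"
  shows "mass x S (\<lambda>z. if z (i, j) then E1 z else E0 z) =
    mass x (S(i := {y \<in> S i. \<not> y j})) E0 + mass x (S(i := {y \<in> S i. y j})) E1"
proof -
  let ?S0 = "S(i := {y \<in> S i. \<not> y j})" and ?S1 = "S(i := {y \<in> S i. y j})"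
  have S0: "PiE I ?S0 = {Z \<in> PiE I S. \<not> Z i j}" and S1: "PiE I ?S1 = {Z \<in> PiE I S. Z i j}"
    using q by (auto simp: PiE_iff extensional_def split: if_splits)
  have z: "join_rows I J Z (i, j) = Z i j" for Z using q by (simp add: join_rows_def)
  have "PiE I S = {Z \<in> PiE I S. \<not> Z i j} \<union> {Z \<in> PiE I S. Z i j}" by auto
  then have "mass x S (\<lambda>z. if z (i, j) then E1 z else E0 z) =
      (\<Sum>Z\<in>{Z \<in> PiE I S. \<not> Z i j} \<union> {Z \<in> PiE I S. Z i j}.
        weight x Z * of_bool (if Z i j then E1 (join_rows I J Z) else E0 (join_rows I J Z)))"
    unfolding mass_def z by simp
  also have "\<dots> = mass x ?S0 E0 + mass x ?S1 E1"
    unfolding mass_def S0 S1 using finite_rows[OF S]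
    by (subst sum.union_disjoint) (auto intro!: arg_cong2[of _ _ _ _ "(+)"] sum.cong)
  finally show ?thesis .
qed

lemma affinity_split_le:
  assumes S: "\<And>i. i \<in> I \<Longrightarrow> S i \<subseteq> X" and q: "i \<in> I" "j \<in> J"
  shows "affinity x x' (S(i := {y \<in> S i. \<not> y j})) h0 + affinity x x' (S(i := {y \<in> S i. y j})) h1
    \<le> affinity x x' S (\<lambda>z. if z (i, j) then h1 z else h0 z)"
proof -
  have if_eq: "(\<lambda>z. (if z (i, j) then h1 z else h0 z) = b) = (\<lambda>z. if z (i, j) then h1 z = b else h0 z = b)"
    for b by auto
  have split: "mass y S (\<lambda>z. if z (i, j) then E1 z else E0 z) =
      mass y (S(i := {y \<in> S i. \<not> y j})) E0 + mass y (S(i := {y \<in> S i. y j})) E1" for y E0 E1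
    using assms by (rule mass_split)
  show ?thesis
    unfolding affinity_def sum.distrib[symmetric] if_eq split
    by (intro sum_mono sqrt_mult_add_le mass_nonneg)
qed

text \<open>A constant output leaves only the total masses, which factor over the rows. Outside
  \<open>B\<close> both factors agree and the root disappears; inside \<open>B\<close> one factor
  comes from each value, in an order that does not matter.\<close>

lemma affinity_const:
  assumes S: "\<And>i. i \<in> I \<Longrightarrow> S i \<subseteq> X"
  shows "affinity x (flip_block x B) S (\<lambda>_. v) =
    (\<Prod>i\<in>I. if i \<in> B then sqrt (sum (p False) (S i) * sum (p True) (S i)) else sum (p (x i)) (S i))"
proof -
  have "mass y S (\<lambda>_. False) = 0" for y by (simp add: mass_def)
  then have "affinity x (flip_block x B) S (\<lambda>_. v) =
      sqrt (mass x S (\<lambda>_. True) * mass (flip_block x B) S (\<lambda>_. True))"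
    by (cases v) (simp_all add: affinity_def UNIV_bool)
  also have "\<dots> = (\<Prod>i\<in>I. sqrt (sum (p (x i)) (S i) * sum (p (flip_block x B i)) (S i)))"
    by (simp add: mass_True[OF S] sqrt_prod flip: prod.distrib)
  also have "\<dots> = (\<Prod>i\<in>I. if i \<in> B then sqrt (sum (p False) (S i) * sum (p True) (S i))
      else sum (p (x i)) (S i))"
  proof (intro prod.cong refl)
    fix i
    show "sqrt (sum (p (x i)) (S i) * sum (p (flip_block x B i)) (S i)) =
        (if i \<in> B then sqrt (sum (p False) (S i) * sum (p True) (S i)) else sum (p (x i)) (S i))"
      by (cases "x i") (auto simp: flip_block_def mult.commute sum_nonneg p_nonneg)
  qed
  finally show ?thesis .
qed

text \<open>Induction on \<open>t\<close>. A query in a row of \<open>B\<close> costs a factor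
  \<open>\<beta>\<close> and one unit of budget by \<open>V_step\<close>; a query in another row
  costs nothing, since ordinary mass is additive. At a leaf or a truncation, \<open>V_gm\<close>
  compares the potential with \<open>affinity_const\<close>.\<close>

lemma block_potential_le_affinity:
  assumes \<beta>: "\<beta> \<ge> 1"
    and V_nonneg: "\<And>e \<sigma>. \<sigma> \<subseteq> X \<Longrightarrow> 0 \<le> V e \<sigma>"
    and V_gm: "\<And>e \<sigma>. \<sigma> \<subseteq> X \<Longrightarrow> V e \<sigma> \<le> sqrt (sum (p False) \<sigma> * sum (p True) \<sigma>)"
    and V_Suc: "\<And>e \<sigma>. \<sigma> \<subseteq> X \<Longrightarrow> V (Suc e) \<sigma> \<le> V e \<sigma>"
    and V_step: "\<And>e \<sigma> j. j \<in> J \<Longrightarrow> \<sigma> \<subseteq> X \<Longrightarrow>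
      V (Suc e) \<sigma> \<le> \<beta> * (V e {y\<in>\<sigma>. \<not> y j} + V e {y\<in>\<sigma>. y j})"
    and t: "set_dtree t \<subseteq> I \<times> J" and S: "\<And>i. i \<in> I \<Longrightarrow> S i \<subseteq> X"
  shows "(\<Prod>i\<in>I. if i \<in> B then V d (S i) else sum (p (x i)) (S i))
    \<le> \<beta> ^ d * affinity x (flip_block x B) S (truncated_output B v t d)"
  using t S
proof (induction t arbitrary: d S)
  let ?U = "\<lambda>d i \<sigma>. if i \<in> B then V d \<sigma> else sum (p (x i)) \<sigma>"
  let ?A = "affinity x (flip_block x B)"
  have U_nonneg: "0 \<le> ?U d i \<sigma>" if "\<sigma> \<subseteq> X" for d i \<sigma>
    using that V_nonneg p_nonneg by (auto intro: sum_nonneg)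
  have const: "(\<Prod>i\<in>I. ?U d i (S i)) \<le> \<beta> ^ d * ?A S (\<lambda>_. b)"
    if S: "\<And>i. i \<in> I \<Longrightarrow> S i \<subseteq> X" for d S b
  proof -
    have "?A S (\<lambda>_. b) = (\<Prod>i\<in>I. if i \<in> B then sqrt (sum (p False) (S i) * sum (p True) (S i))
        else sum (p (x i)) (S i))"
      using S by (rule affinity_const)
    moreover have "(\<Prod>i\<in>I. ?U d i (S i)) \<le> \<dots>"
      using S U_nonneg V_gm by (intro prod_mono) auto
    ultimately have "(\<Prod>i\<in>I. ?U d i (S i)) \<le> ?A S (\<lambda>_. b)" by simp
    also have "\<dots> = 1 * ?A S (\<lambda>_. b)" by simp
    also have "\<dots> \<le> \<beta> ^ d * ?A S (\<lambda>_. b)"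
      using \<beta> by (intro mult_right_mono) (auto simp: affinity_def mass_nonneg intro!: sum_nonneg)
    finally show ?thesis .
  qed
  {
    case (Leaf b)
    then show ?case using const[of S d b] by simp
  next
    case (Query q t0 t1)
    obtain i j where q: "q = (i, j)" "i \<in> I" "j \<in> J" using Query.prems by auto
    show ?case
    proof (cases "i \<in> B \<and> d = 0")
      case True
      then show ?thesis using const[of S d v] Query.prems q by simp
    next
      case False
      define e where "e = d - of_bool (i \<in> B)"
      define \<gamma> where "\<gamma> = (if i \<in> B then \<beta> else 1)"
      let ?S0 = "S(i := {y \<in> S i. \<not> y j})" and ?S1 = "S(i := {y \<in> S i. y j})"
      have "\<gamma> \<ge> 0" and \<gamma>: "\<gamma> * \<beta> ^ e = \<beta> ^ d"
        using \<beta> False by (auto simp: \<gamma>_def e_def simp flip: power_Suc)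
      have Si: "S i \<subseteq> X" using Query.prems q by auto
      have step: "?U d i (S i) \<le> \<gamma> * (?U e i {y \<in> S i. \<not> y j} + ?U e i {y \<in> S i. y j})"
      proof (cases "i \<in> B")
        case True
        then show ?thesis using V_step[of j "S i" e] False q Si by (simp add: e_def \<gamma>_def)
      next
        case False
        have "S i = {y \<in> S i. \<not> y j} \<union> {y \<in> S i. y j}" by auto
        then have "sum (p (x i)) (S i) = sum (p (x i)) ({y \<in> S i. \<not> y j} \<union> {y \<in> S i. y j})" by simp
        also have "\<dots> = sum (p (x i)) {y \<in> S i. \<not> y j} + sum (p (x i)) {y \<in> S i. y j}"
          using finite_subset[OF Si finite_X] by (intro sum.union_disjoint) auto
        finally show ?thesis using False by (simp add: \<gamma>_def)
      qed
      \<comment> \<open>All rows of \<open>B\<close> share one budget, so it drops for the rows not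
        queried as well; this can only raise their potentials.\<close>
      have mono: "?U d k \<sigma> \<le> ?U e k \<sigma>" if "\<sigma> \<subseteq> X" for k \<sigma>
        using V_Suc[of \<sigma> e] that False by (cases "i \<in> B") (auto simp: e_def)
      have split: "(\<Prod>k\<in>I. ?U e k ((S(i := \<sigma>)) k)) = ?U e i \<sigma> * (\<Prod>k\<in>I - {i}. ?U e k (S k))" for \<sigma>
      proof -
        have "(\<Prod>k\<in>I - {i}. ?U e k ((S(i := \<sigma>)) k)) = (\<Prod>k\<in>I - {i}. ?U e k (S k))"
          by (intro prod.cong) auto
        then show ?thesis by (subst prod.remove[OF finite_I q(2)]) simp
      qed
      have "(\<Prod>k\<in>I. ?U d k (S k)) = ?U d i (S i) * (\<Prod>k\<in>I - {i}. ?U d k (S k))"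
        by (rule prod.remove[OF finite_I q(2)])
      also have "\<dots> \<le> (\<gamma> * (?U e i {y \<in> S i. \<not> y j} + ?U e i {y \<in> S i. y j})) *
          (\<Prod>k\<in>I - {i}. ?U e k (S k))"
        using Query.prems U_nonneg mono Si order_trans[OF U_nonneg step]
        by (intro mult_mono step prod_mono prod_nonneg) auto
      also have "\<dots> = \<gamma> * ((\<Prod>k\<in>I. ?U e k (?S0 k)) + (\<Prod>k\<in>I. ?U e k (?S1 k)))"
        unfolding split by (simp add: algebra_simps)
      also have "\<dots> \<le> \<gamma> * (\<beta> ^ e * ?A ?S0 (truncated_output B v t0 e)
          + \<beta> ^ e * ?A ?S1 (truncated_output B v t1 e))"
        using Query.prems Si \<open>\<gamma> \<ge> 0\<close> by (intro mult_left_mono add_mono Query.IH) auto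
      also have "\<dots> = \<beta> ^ d * (?A ?S0 (truncated_output B v t0 e) + ?A ?S1 (truncated_output B v t1 e))"
        unfolding \<gamma>[symmetric] by (simp add: algebra_simps)
      also have "\<dots> \<le> \<beta> ^ d * ?A S (\<lambda>z. if z (i, j) then truncated_output B v t1 e z
          else truncated_output B v t0 e z)"
        using Query.prems q \<beta> by (intro mult_left_mono affinity_split_le) auto
      also have "(\<lambda>z. if z (i, j) then truncated_output B v t1 e z else truncated_output B v t0 e z)
          = truncated_output B v (Query q t0 t1) d"
        using False q by (auto simp: e_def fun_eq_iff)
      finally show ?thesis .
    qed
  }
qed

end

context row_distributions
begin

lemma mass_add_compl:
  "mass x S (\<lambda>z. h z = b) + mass x S (\<lambda>z. h z = (\<not> b)) = mass x S (\<lambda>_. True)"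
  unfolding mass_def sum.distrib[symmetric] by (intro sum.cong) auto

text \<open>Under \<open>x\<close> truncation does harm only after at least \<open>d + 1\<close>
  queries in \<open>B\<close>, which Markov's inequality bounds. Under \<open>x'\<close> the default
  \<open>\<not> b\<close> is the desired answer, so truncation never hurts; hence only the cost
  under \<open>x\<close> enters.\<close>

lemma truncated_advantage:
  assumes S: "\<And>i. i \<in> I \<Longrightarrow> S i \<subseteq> X"
    and total: "mass x S (\<lambda>_. True) = 1" "mass x' S (\<lambda>_. True) = 1"
  shows "mass x S (\<lambda>z. dtree_output t z = b) + mass x' S (\<lambda>z. dtree_output t z = (\<not> b))
      - (\<Sum>Z\<in>PiE I S. weight x Z * real (block_queries B t (join_rows I J Z))) / real (Suc d) - 1
    \<le> mass x S (\<lambda>z. truncated_output B (\<not> b) t d z = b)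
      - mass x' S (\<lambda>z. truncated_output B (\<not> b) t d z = b)"
proof -
  let ?z = "join_rows I J" and ?tr = "truncated_output B (\<not> b) t d"
  have fin: "finite (PiE I S)" using S by (rule finite_rows)
  have "mass x S (\<lambda>z. dtree_output t z = b) - mass x S (\<lambda>z. ?tr z = b)
      \<le> (\<Sum>Z\<in>PiE I S. weight x Z * real (block_queries B t (?z Z)) / real (Suc d))"
    unfolding mass_def sum_subtractf[symmetric]
  proof (intro sum_mono)
    fix Z
    have "of_bool (dtree_output t (?z Z) = b) - of_bool (?tr (?z Z) = b)
        \<le> real (block_queries B t (?z Z)) / real (Suc d)"
    proof (cases "block_queries B t (?z Z) > d")
      case True
      then have "1 \<le> real (block_queries B t (?z Z)) / real (Suc d)" by (simp add: field_simps)
      moreover have "of_bool (dtree_output t (?z Z) = b) - of_bool (?tr (?z Z) = b) \<le> (1::real)"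
        by (simp add: of_bool_def)
      ultimately show ?thesis by linarith
    qed (simp add: truncated_output_eq)
    then have "weight x Z * (of_bool (dtree_output t (?z Z) = b) - of_bool (?tr (?z Z) = b))
        \<le> weight x Z * (real (block_queries B t (?z Z)) / real (Suc d))"
      by (intro mult_left_mono weight_nonneg)
    then show "weight x Z * of_bool (dtree_output t (?z Z) = b) - weight x Z * of_bool (?tr (?z Z) = b)
        \<le> weight x Z * real (block_queries B t (?z Z)) / real (Suc d)"
      by (simp add: right_diff_distrib)
  qed
  moreover have "mass x' S (\<lambda>z. ?tr z = b) \<le> mass x' S (\<lambda>z. dtree_output t z = b)"
    unfolding mass_def
    by (intro sum_mono mult_left_mono weight_nonneg) (auto simp: truncated_output_eq)
  moreover have "mass x' S (\<lambda>z. dtree_output t z = b) + mass x' S (\<lambda>z. dtree_output t z = (\<not> b)) = 1"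
    using mass_add_compl[of x' S "dtree_output t" b] total by simp
  ultimately show ?thesis by (simp add: sum_divide_distrib)
qed

end

subsection \<open>The composition bound\<close>

lemma finite_sensitive_blocks: "finite I \<Longrightarrow> finite (sensitive_blocks I f x)"
  by (rule finite_subset[of _ "Pow I"]) (auto simp: sensitive_blocks_def)

lemma exists_gt_weighted_average:
  fixes w :: "'b \<Rightarrow> real"
  assumes "finite \<B>" and w: "\<And>B. B \<in> \<B> \<Longrightarrow> 0 \<le> w B"
    and "u * sum w \<B> < (\<Sum>B\<in>\<B>. w B * h B)"
  shows "\<exists>B\<in>\<B>. u < h B"
proof (rule ccontr)
  assume "\<not> ?thesis"
  then have "(\<Sum>B\<in>\<B>. w B * h B) \<le> (\<Sum>B\<in>\<B>. w B * u)"
    using w by (intro sum_mono mult_left_mono) (auto simp: not_less)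
  with assms(3) show False by (simp add: mult.commute flip: sum_distrib_left)
qed

lemma finite_dom_partial_boolfun: "finite I \<Longrightarrow> partial_boolfun I h \<Longrightarrow> finite (dom h)"
  by (rule finite_subset[of _ "cube I"]) (simp_all add: partial_boolfun_def cube_def finite_PiE)

text \<open>The two success probabilities sum to 4/3 on average, that is 1/3 above guessing. The
  condition on \<open>k\<close> limits the truncation loss to less than 1/6, so some block keeps an
  advantage above 1/6 and has squared affinity at most \<open>1 - 1/36 = 35/36\<close>, against the
  lower bound from the potential.\<close>

lemma composition_bound:
  fixes f :: "('i \<Rightarrow> bool) \<Rightarrow> bool option" and g :: "('j \<Rightarrow> bool) \<Rightarrow> bool option"
    and \<beta> :: real
  assumes fin: "finite I" "finite (dom g)" and f: "partial_boolfun I f" and g: "partial_boolfun J g"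
    and x: "x \<in> dom f" and w: "w \<in> feasible_weights I f x"
    and D: "queries_at_most (I \<times> J) D k" "computes D (boolfun_comp I J f g)"
    and k: "6 * real k < real (Suc d) * (\<Sum>B\<in>sensitive_blocks I f x. w B)"
    and \<beta>: "\<beta> \<ge> 1" "\<beta> ^ s > 3" "(\<beta> ^ d)\<^sup>2 * (35 / 36) < 1"
  shows "rand_query J g \<le> s - 1 + d"
proof (rule ccontr)
  assume "\<not> ?thesis"
  then have "s - 1 + d < rand_query J g" by simp
  then obtain p V where p: "\<And>b y. 0 \<le> p b y" "\<And>b y. p b y \<noteq> 0 \<Longrightarrow> g y = Some b"
      "\<And>b. sum (p b) (dom g) = 1"
    and V: "\<And>e \<sigma>. \<sigma> \<subseteq> dom g \<Longrightarrow> 0 \<le> V e \<sigma>"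
      "\<And>e \<sigma>. \<sigma> \<subseteq> dom g \<Longrightarrow> V e \<sigma> \<le> sqrt (sum (p False) \<sigma> * sum (p True) \<sigma>)"
      "\<And>e \<sigma>. \<sigma> \<subseteq> dom g \<Longrightarrow> V (Suc e) \<sigma> \<le> V e \<sigma>"
      "\<And>e \<sigma> j. j \<in> J \<Longrightarrow> \<sigma> \<subseteq> dom g \<Longrightarrow>
        V (Suc e) \<sigma> \<le> \<beta> * (V e {y\<in>\<sigma>. \<not> y j} + V e {y\<in>\<sigma>. y j})"
      "(1::real) \<le> V d (dom g)"
    by (rule hard_pair[OF fin(2) \<beta>(1,2)]) blast
  interpret row_distributions I J "dom g" p
    using fin p(1) by unfold_locales auto
  let ?S = "\<lambda>_. dom g" and ?\<B> = "sensitive_blocks I f x" and ?z = "join_rows I J"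
  let ?F = "sum w ?\<B>" and ?R = "PiE I (\<lambda>_. dom g)"
  have finB: "finite ?\<B>" using fin(1) by (rule finite_sensitive_blocks)
  have finR: "finite ?R" by (rule finite_rows) simp
  have w0: "0 \<le> w B" if "B \<in> ?\<B>" for B using w that by (simp add: feasible_weights_def)
  have w1: "(\<Sum>B | B \<in> ?\<B> \<and> i \<in> B. w B) \<le> 1" if "i \<in> I" for i
    using w that by (simp add: feasible_weights_def)
  have total: "mass y ?S (\<lambda>_. True) = 1" for y
    by (subst mass_True) (simp_all add: p(3))
  then have total': "(\<Sum>Z\<in>?R. weight y Z) = 1" for y by (simp add: mass_def)
  obtain v where v: "f x = Some v" using x by auto
  \<comment> \<open>The flag \<open>c\<close> selects the side, so that one sum over
    \<open>K\<close> covers correctness on both \<open>x\<close> and its flip for every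
    block.\<close>
  define x' where "x' B c = (if c then x else flip_block x B)" for B c
  have x': "f (x' B c) = Some (if c then v else \<not> v)" if "B \<in> ?\<B>" for B c
    using that v by (auto simp: x'_def sensitive_blocks_def)
  define K where "K = ?\<B> \<times> ?R \<times> (UNIV :: bool set)"
  have "\<exists>t\<in>set_pmf D. 2 / 3 * (\<Sum>(B, Z, c)\<in>K. w B * weight (x' B c) Z) \<le>
      (\<Sum>\<kappa>\<in>K. (case \<kappa> of (B, Z, c) \<Rightarrow> w B * weight (x' B c) Z) *
        of_bool (case \<kappa> of (B, Z, c) \<Rightarrow> dtree_output t (?z Z) = (if c then v else \<not> v)))"
  proof (rule exists_outcome_ge_average)
    show "finite K" using finB finR by (simp add: K_def)
    show "0 \<le> (case \<kappa> of (B, Z, c) \<Rightarrow> w B * weight (x' B c) Z)" if "\<kappa> \<in> K" for \<kappa>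
      using that w0 weight_nonneg by (auto simp: K_def)
    show "2 / 3 \<le> measure_pmf.prob D
        {t. case \<kappa> of (B, Z, c) \<Rightarrow> dtree_output t (?z Z) = (if c then v else \<not> v)}"
      if \<kappa>: "\<kappa> \<in> K" "(case \<kappa> of (B, Z, c) \<Rightarrow> w B * weight (x' B c) Z) \<noteq> 0" for \<kappa>
    proof -
      obtain B Z c where BZc: "\<kappa> = (B, Z, c)" by (cases \<kappa>) auto
      have B: "B \<in> ?\<B>" using \<kappa> BZc by (auto simp: K_def)
      \<comment> \<open>A nonzero weight puts every row in the support of its distribution, so the
        composed input lies in the domain.\<close>
      have "g (Z i) = Some (x' B c i)" if "i \<in> I" for i
        using \<kappa>(2) that fin(1) by (intro p(2)) (auto simp: BZc weight_def)
      then have fz: "boolfun_comp I J f g (?z Z) = Some (if c then v else \<not> v)"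
        using x'[OF B, of c] by (subst boolfun_comp_join_rows[OF f g, of "x' B c"]) auto
      then have "?z Z \<in> dom (boolfun_comp I J f g)" by auto
      with D(2) have "2 / 3 \<le> measure_pmf.prob D
          {t. Some (dtree_output t (?z Z)) = boolfun_comp I J f g (?z Z)}"
        unfolding computes_def by blast
      then show ?thesis by (simp only: fz BZc prod.case option.inject)
    qed
  qed
  then obtain t where tD: "t \<in> set_pmf D" and t: "2 / 3 * (\<Sum>(B, Z, c)\<in>K. w B * weight (x' B c) Z) \<le>
      (\<Sum>(B, Z, c)\<in>K. w B * weight (x' B c) Z * of_bool (dtree_output t (?z Z) = (if c then v else \<not> v)))"
    by (auto simp: case_prod_unfold)
  have tIJ: "set_dtree t \<subseteq> I \<times> J" and tk: "z \<in> cube (I \<times> J) \<Longrightarrow> dtree_queries t z \<le> k" for z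
    using D(1) tD by (auto simp: queries_at_most_def)
  have K_sum: "(\<Sum>(B, Z, c)\<in>K. w B * weight (x' B c) Z * of_bool (E c (?z Z))) =
      (\<Sum>B\<in>?\<B>. w B * (mass x ?S (E True) + mass (flip_block x B) ?S (E False)))" for E
    unfolding K_def sum.cartesian_product[symmetric] mass_def
    by (simp add: x'_def UNIV_bool sum.distrib distrib_left sum_distrib_left mult.assoc add.commute)
  have "(\<Sum>(B, Z, c)\<in>K. w B * weight (x' B c) Z) = 2 * ?F"
    using K_sum[of "\<lambda>_ _. True"] by (simp add: total sum_distrib_left mult.commute)
  with t have acc: "4 / 3 * ?F \<le> (\<Sum>B\<in>?\<B>. w B * (mass x ?S (\<lambda>z. dtree_output t z = v)
      + mass (flip_block x B) ?S (\<lambda>z. dtree_output t z = (\<not> v))))"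
    using K_sum[of "\<lambda>c z. dtree_output t z = (if c then v else \<not> v)"] by simp
  let ?q = "\<lambda>B. \<Sum>Z\<in>?R. weight x Z * real (block_queries B t (?z Z))"
  \<comment> \<open>Exchanging the sums allows the packing bound to be applied to each input
    separately.\<close>
  have "(\<Sum>B\<in>?\<B>. w B * ?q B) =
      (\<Sum>Z\<in>?R. weight x Z * (\<Sum>B\<in>?\<B>. w B * real (block_queries B t (?z Z))))"
    unfolding sum_distrib_left by (subst sum.swap) (simp add: mult.left_commute)
  also have "\<dots> \<le> (\<Sum>Z\<in>?R. weight x Z * real k)"
  proof (intro sum_mono mult_left_mono weight_nonneg)
    fix Z
    have "(\<Sum>B\<in>?\<B>. w B * real (block_queries B t (?z Z))) \<le> real (dtree_queries t (?z Z))"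
      using finB w1 tIJ by (rule weighted_block_queries_le)
    also have "dtree_queries t (?z Z) \<le> k" by (intro tk) (auto simp: join_rows_def cube_def)
    finally show "(\<Sum>B\<in>?\<B>. w B * real (block_queries B t (?z Z))) \<le> real k" by simp
  qed
  also have "\<dots> = real k" by (simp add: total' flip: sum_distrib_right)
  finally have "(\<Sum>B\<in>?\<B>. w B * ?q B) / real (Suc d) \<le> real k / real (Suc d)"
    by (rule divide_right_mono) simp
  also have "\<dots> < ?F / 6" using k by (simp add: field_simps)
  finally have cost: "(\<Sum>B\<in>?\<B>. w B * (?q B / real (Suc d))) < ?F / 6"
    by (simp only: times_divide_eq_right flip: sum_divide_distrib)
  have gap: "1 / 6 * ?F < (\<Sum>B\<in>?\<B>. w B * (mass x ?S (\<lambda>z. dtree_output t z = v)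
      + mass (flip_block x B) ?S (\<lambda>z. dtree_output t z = (\<not> v)) - ?q B / real (Suc d) - 1))"
    using acc cost by (simp add: right_diff_distrib sum_subtractf)
  obtain B where "1 / 6 < mass x ?S (\<lambda>z. dtree_output t z = v)
      + mass (flip_block x B) ?S (\<lambda>z. dtree_output t z = (\<not> v)) - ?q B / real (Suc d) - 1"
    using exists_gt_weighted_average[OF finB _ gap] w0 by blast
  also have "\<dots> \<le> mass x ?S (\<lambda>z. truncated_output B (\<not> v) t d z = v)
      - mass (flip_block x B) ?S (\<lambda>z. truncated_output B (\<not> v) t d z = v)" (is "_ \<le> ?P - ?Q")
    by (intro truncated_advantage total) simp
  finally have PQ: "1 / 6 < ?P - ?Q" .
  let ?tr = "truncated_output B (\<not> v) t d" and ?a = "affinity x (flip_block x B) ?S (truncated_output B (\<not> v) t d)"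
  have "?P + mass x ?S (\<lambda>z. ?tr z = (\<not> v)) = 1" "?Q + mass (flip_block x B) ?S (\<lambda>z. ?tr z = (\<not> v)) = 1"
    by (simp_all only: mass_add_compl total)
  then have P': "mass x ?S (\<lambda>z. ?tr z = (\<not> v)) = 1 - ?P"
    and Q': "mass (flip_block x B) ?S (\<lambda>z. ?tr z = (\<not> v)) = 1 - ?Q" by simp_all
  have PQ01: "0 \<le> ?P" "?P \<le> 1" "0 \<le> ?Q" "?Q \<le> 1"
    using P' Q' mass_nonneg[of x ?S] mass_nonneg[of "flip_block x B" ?S] by (metis diff_ge_0_iff_ge)+
  have "?a = sqrt (?P * ?Q) + sqrt ((1 - ?P) * (1 - ?Q))"
    unfolding affinity_def P'[symmetric] Q'[symmetric] by (cases v) (simp_all add: UNIV_bool)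
  then have "?a\<^sup>2 \<le> 1 - (?P - ?Q)\<^sup>2" using affinity_le[OF PQ01] by simp
  moreover have "(1 / 6)\<^sup>2 \<le> (?P - ?Q)\<^sup>2" using PQ by (intro power_mono) auto
  ultimately have a: "?a\<^sup>2 \<le> 35 / 36" by (simp add: power_divide)
  \<comment> \<open>At the root, rows in \<open>B\<close> contribute at least 1 by
    \<open>V(5)\<close>, and all other rows contribute exactly 1.\<close>
  have "1 \<le> (\<Prod>i\<in>I. if i \<in> B then V d (dom g) else sum (p (x i)) (dom g))"
    using V(5) p(3) by (intro prod_ge_1) auto
  also have "\<dots> \<le> \<beta> ^ d * ?a"
    by (rule block_potential_le_affinity) (use \<beta> V tIJ in auto)
  finally have "1\<^sup>2 \<le> (\<beta> ^ d * ?a)\<^sup>2" by (intro power_mono) auto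
  also have "\<dots> = (\<beta> ^ d)\<^sup>2 * ?a\<^sup>2" by (simp add: power_mult_distrib)
  also have "\<dots> \<le> (\<beta> ^ d)\<^sup>2 * (35 / 36)" using a by (intro mult_left_mono) auto
  finally show False using \<beta>(3) by simp
qed

section \<open>Trees that attain the query complexity\<close>

lemma dtree_for_function:
  assumes "finite I"
  shows "\<exists>t. set_dtree t \<subseteq> I \<and> (\<forall>x. dtree_queries t x \<le> card I) \<and>
    (\<forall>x\<in>cube I. dtree_output t x = h x)"
proof -
  \<comment> \<open>The induction is over the positions \<open>A\<close> still to be read;
    \<open>y\<close> records the bits fixed so far. Starting from \<open>undefined\<close> matches
    extensionality of \<open>cube I\<close>.\<close>
  have "\<exists>t. set_dtree t \<subseteq> A \<and> (\<forall>x. dtree_queries t x \<le> card A) \<and>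
      (\<forall>x. dtree_output t x = h (\<lambda>i. if i \<in> A then x i else y i))" if "finite A" for A y
    using that
  proof (induction A arbitrary: y)
    case empty
    show ?case by (intro exI[of _ "Leaf (h y)"]) simp
  next
    case (insert a A)
    from insert.IH[of "y(a := False)"] insert.IH[of "y(a := True)"] obtain t0 t1
      where t: "set_dtree t0 \<subseteq> A" "\<forall>x. dtree_queries t0 x \<le> card A"
          "\<forall>x. dtree_output t0 x = h (\<lambda>i. if i \<in> A then x i else (y(a := False)) i)"
        "set_dtree t1 \<subseteq> A" "\<forall>x. dtree_queries t1 x \<le> card A"
          "\<forall>x. dtree_output t1 x = h (\<lambda>i. if i \<in> A then x i else (y(a := True)) i)"
      by blast
    have outputs: "dtree_output (Query a t0 t1) x = h (\<lambda>i. if i \<in> insert a A then x i else y i)" for x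
    proof -
      have "(\<lambda>i. if i \<in> A then x i else (y(a := x a)) i) = (\<lambda>i. if i \<in> insert a A then x i else y i)"
        by auto
      moreover have "dtree_output (Query a t0 t1) x = h (\<lambda>i. if i \<in> A then x i else (y(a := x a)) i)"
        using t(3,6) by (cases "x a") (simp_all del: fun_upd_apply)
      ultimately show ?thesis by (simp only:)
    qed
    have labels: "set_dtree (Query a t0 t1) \<subseteq> insert a A" using t(1,4) by auto
    have queries: "dtree_queries (Query a t0 t1) x \<le> card (insert a A)" for x
      using t(2,5) insert.hyps by simp
    show ?case
      by (intro exI[of _ "Query a t0 t1"] conjI allI labels queries outputs)
  qed
  from this[OF assms, of "\<lambda>_. undefined"] obtain t where t: "set_dtree t \<subseteq> I"
    "\<forall>x. dtree_queries t x \<le> card I"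
    "\<forall>x. dtree_output t x = h (\<lambda>i. if i \<in> I then x i else undefined)" by blast
  moreover have "(\<lambda>i. if i \<in> I then x i else undefined) = x" if "x \<in> cube I" for x
    using that by (auto simp: cube_def PiE_def extensional_def)
  ultimately show ?thesis by (intro exI[of _ t]) auto
qed

text \<open>The tree that reads the whole input shows that the \<open>LEAST\<close> ranges over a
  nonempty set.\<close>

lemma rand_query_attained:
  assumes "finite I" "partial_boolfun I h"
  shows "\<exists>D. queries_at_most I D (rand_query I h) \<and> computes D h"
proof -
  obtain t where t: "set_dtree t \<subseteq> I" "\<forall>x. dtree_queries t x \<le> card I"
      "\<forall>x\<in>cube I. dtree_output t x = the (h x)"
    using dtree_for_function[OF assms(1), of "\<lambda>x. the (h x)"] by blast
  have "computes (return_pmf t) h"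
    unfolding computes_def
  proof
    fix x assume "x \<in> dom h"
    then have "Some (dtree_output t x) = h x" using t(3) assms(2) by (auto simp: partial_boolfun_def)
    then show "2 / 3 \<le> measure_pmf.prob (return_pmf t) {t. Some (dtree_output t x) = h x}"
      by simp
  qed
  moreover have "queries_at_most I (return_pmf t) (card I)"
    using t by (simp add: queries_at_most_def)
  ultimately have "\<exists>k D. queries_at_most I D k \<and> computes D h" by blast
  then show ?thesis unfolding rand_query_def by (rule LeastI_ex)
qed

text \<open>Instantiates the parameters: \<open>\<beta> = 1 + 1 / (100 * d)\<close> is small enough
  for \<open>\<beta> ^ d\<close> to stay near 1, and \<open>s = 200 * d + 1\<close> large enough for
  \<open>\<beta> ^ s\<close> to exceed 3.\<close>

lemma rand_query_le_of_budget:
  fixes f :: "('i \<Rightarrow> bool) \<Rightarrow> bool option" and g :: "('j \<Rightarrow> bool) \<Rightarrow> bool option"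
  assumes "finite I" "finite (dom g)" "partial_boolfun I f" "partial_boolfun J g"
    and "x \<in> dom f" "w \<in> feasible_weights I f x"
    and "queries_at_most (I \<times> J) D k" "computes D (boolfun_comp I J f g)"
    and "6 * real k < real (Suc d) * (\<Sum>B\<in>sensitive_blocks I f x. w B)"
  shows "rand_query J g \<le> 201 * d"
proof (cases "d = 0")
  case True
  \<comment> \<open>For \<open>d = 0\<close> the power \<open>\<beta> ^ d\<close> is 1 for any
    \<open>\<beta>\<close>, so \<open>\<beta> = 4\<close> and \<open>s = 1\<close> already give the
    bound 0.\<close>
  then show ?thesis using composition_bound[OF assms, of 4 1] by simp
next
  case False
  define l where "l = 1 / (100 * real d)"
  have l: "0 < l" "l < 1" "real d * l = 1 / 100" using False by (auto simp: l_def field_simps)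
  have "(1 + l) ^ (200 * d + 1) > 3"
  proof -
    have "1 + real (200 * d + 1) * l \<le> (1 + l) ^ (200 * d + 1)"
      using l by (intro Bernoulli_inequality) auto
    moreover have "real (200 * d + 1) * l = 2 + l" using l(3) by (simp add: algebra_simps)
    ultimately show ?thesis using l by simp
  qed
  moreover have "((1 + l) ^ d)\<^sup>2 * (35 / 36) < 1"
  proof -
    \<comment> \<open>The upper bound on \<open>(1 + l) ^ d\<close> comes from the lower bound
      99/100 on \<open>(1 - l) ^ d\<close>, as the two powers multiply to at most 1.\<close>
    have "1 + real d * (- l) \<le> (1 + - l) ^ d" using l by (intro Bernoulli_inequality) auto
    then have "(1 + l) ^ d * (99 / 100) \<le> (1 + l) ^ d * (1 - l) ^ d"
      using l by (intro mult_left_mono) auto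
    also have "\<dots> = (1 - l\<^sup>2) ^ d"
      by (simp add: power2_eq_square algebra_simps flip: power_mult_distrib)
    also have "\<dots> \<le> 1" using l by (intro power_le_one) (auto simp: power_le_one)
    finally have "(1 + l) ^ d \<le> 100 / 99" by simp
    then have "((1 + l) ^ d)\<^sup>2 \<le> (100 / 99)\<^sup>2" using l by (intro power_mono) auto
    then show ?thesis by (simp add: power2_eq_square)
  qed
  ultimately have "rand_query J g \<le> (200 * d + 1) - 1 + d"
    using l by (intro composition_bound[OF assms]) auto
  then show ?thesis by simp
qed

lemma rand_query_boolfun_comp_ge:
  fixes f :: "('i \<Rightarrow> bool) \<Rightarrow> bool option" and g :: "('j \<Rightarrow> bool) \<Rightarrow> bool option"
  assumes fin: "finite I" "finite J" and f: "partial_boolfun I f" and g: "partial_boolfun J g"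
  shows "1 / 1206 * fbs I f * real (rand_query J g) \<le> real (rand_query (I \<times> J) (boolfun_comp I J f g))"
proof (cases "dom f = {} \<or> rand_query J g = 0")
  case True
  then show ?thesis by (auto simp: fbs_def)
next
  case False
  let ?k = "rand_query (I \<times> J) (boolfun_comp I J f g)" and ?r = "real (rand_query J g)"
  have "partial_boolfun (I \<times> J) (boolfun_comp I J f g)"
    by (auto simp: partial_boolfun_def boolfun_comp_def split: if_splits)
  then obtain D where D: "queries_at_most (I \<times> J) D ?k" "computes D (boolfun_comp I J f g)"
    using rand_query_attained[of "I \<times> J"] fin by blast
  have fin_f: "finite (dom f)" and fin_g: "finite (dom g)"
    by (rule finite_dom_partial_boolfun[OF fin(1) f] finite_dom_partial_boolfun[OF fin(2) g])+
  have "fbs_at I f x \<le> 1206 * real ?k / ?r" if x: "x \<in> dom f" for x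
    unfolding fbs_at_def
  proof (rule cSUP_least)
    have "(\<lambda>_. 0) \<in> feasible_weights I f x" by (simp add: feasible_weights_def)
    then show "feasible_weights I f x \<noteq> {}" by blast
    fix w assume w: "w \<in> feasible_weights I f x"
    let ?F = "\<Sum>B\<in>sensitive_blocks I f x. w B"
    show "?F \<le> 1206 * real ?k / ?r"
    proof (cases "?F > 0")
      case True
      \<comment> \<open>The least \<open>d\<close> with \<open>6 * ?k < (d + 1) * ?F\<close>. The
        final constant is \<open>1206 = 6 * 201\<close>.\<close>
      define d where "d = nat \<lfloor>6 * real ?k / ?F\<rfloor>"
      have d: "real d \<le> 6 * real ?k / ?F" "6 * real ?k / ?F < real (Suc d)"
        using True by (auto simp: d_def) linarith+
      have "6 * real ?k < real (Suc d) * ?F" using d(2) True by (simp add: field_simps)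
      then have "rand_query J g \<le> 201 * d"
        using rand_query_le_of_budget[OF fin(1) fin_g f g x w D] by blast
      then have "?r \<le> 201 * (6 * real ?k / ?F)" using d(1) by linarith
      then show ?thesis using True False by (simp add: field_simps)
    next
      case False
      then have "?F \<le> 0" by (simp only: not_less)
      also have "0 \<le> 1206 * real ?k / ?r" by simp
      finally show ?thesis .
    qed
  qed
  then have "fbs I f \<le> 1206 * real ?k / ?r" using False fin_f by (simp add: fbs_def)
  then show ?thesis using False by (simp add: field_simps)
qed

theorem theorem6:
  shows "\<exists>c::real. c > 0 \<and>
    (\<forall>(n::nat) (m::nat) (f :: (nat \<Rightarrow> bool) \<Rightarrow> bool option) (g :: (nat \<Rightarrow> bool) \<Rightarrow> bool option).
      partial_boolfun {..<n} f \<longrightarrow> partial_boolfun {..<m} g \<longrightarrow>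
      real (rand_query ({..<n} \<times> {..<m}) (boolfun_comp {..<n} {..<m} f g))
        \<ge> c * fbs {..<n} f * real (rand_query {..<m} g))"
  by (intro exI[of _ "1 / 1206"] conjI allI impI rand_query_boolfun_comp_ge) auto

end
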